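(* Let $G=(V,E)$ be a finite directed acyclic network with source $s$ and sink set $T$, let $r$ be an integer with $0\le r\le C_{\min}$, and let $\mathbb{F}_q$ be a finite field of order $q>\max\{|T|,|\mathscr{A}_r|\}$, where $\mathscr{A}_r$ is the set of primary edge subsets of $G$ of size $r$. Then there exists a local-encoding-preserving family of secure linear network codes over $\mathbb{F}_q$ on $G$, all with security level $r$, with information rates $\omega=C_{\min}-r,\,C_{\min}-r-1,\dots,1,0$. That is, there are matrices $K_v$ over $\mathbb{F}_q$, $v\in V\setminus(\{s\}\cup T)$, and for each $\omega\in\{0,1,\dots,C_{\min}-r\}$ an $(\omega+r)\times|\mathrm{Out}(s)|$ matrix $K_s^{[\omega]}$ over $\mathbb{F}_q$, such that for each such $\omega$ the $(\omega+r)$-dimensional linear network code with local encoding kernel $K_s^{[\omega]}$ at $s$ and $K_v$ at every intermediate node $v$ is a secure linear network code with rate $\omega$ and security level $r$.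
   Context: Network. $G=(V,E)$ is a finite directed acyclic graph (parallel edges allowed, each edge of capacity 1) with a single source $s$ having no incoming edges in $E$, and a nonempty set of sink nodes $T\subseteq V\setminus\{s\}$ having no outgoing edges. $\mathrm{In}(v)$, $\mathrm{Out}(v)$ are the sets of incoming and outgoing edges of $v$. For an $n$-dimensional code, $\mathrm{In}(s)=\{d_1,\dots,d_n\}$ is a set of $n$ imaginary incoming edges of $s$ (not in $E$). $C_t$ is the minimum cut capacity between $s$ and $t$ (least number of edges whose removal disconnects $s$ from $t$), and $C_{\min}=\min_{t\in T}C_t$. Intermediate nodes are those in $V\setminus(\{s\}\cup T)$. Linear network code. An $n$-dimensional $\mathbb{F}_q$-valued linear network code on $G$ is a collection $\{K_v: v\in V\setminus T\}$ where $K_v=[k_{d,e}]_{d\in \mathrm{In}(v),e\in \mathrm{Out}(v)}$ is a matrix over $\mathbb{F}_q$ (the local encoding kernel at $v$). With input a row vector $\mathbf{x}=(x_1,\dots,x_n)\in\mathbb{F}_q^n$ at $s$, the symbol $y_e$ transmitted on edge $e$ is defined recursively by $y_{d_i}=x_i$ and $y_e=\sum_{d\in\mathrm{In}(\mathrm{tail}(e))}k_{d,e}\,y_d$. Secure linear network code (SLNC). Let $\omega,r\ge 0$ and $n=\omega+r$. The source message $M$ is uniform on $\mathbb{F}_q^{\omega}$, the key $K$ is uniform on $\mathbb{F}_q^r$ and independent of $M$, and the input is $\mathbf{x}=(M\ \ K)$. Let $Y_e$ be the resulting random symbol on edge $e$ and $Y_A=(Y_e:e\in A)$. An $n$-dimensional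 linear network code is an SLNC with rate $\omega$ and security level $r$ if (decoding condition) for every $t\in T$, $M$ is a function of $(Y_e:e\in\mathrm{In}(t))$, i.e. $t$ decodes $M$ with zero error; and (security condition) the mutual information $I(Y_A;M)=0$ for every $A\subseteq E$ with $|A|\le r$. Local-encoding-preserving. A family of SLNCs on $G$ is local-encoding-preserving if all of them have the same local encoding kernel at each intermediate node. Primary edge subsets. For $A\subseteq E$, a cut between $s$ and $A$ is a set of edges $C\subseteq E$ such that every directed path starting at $s$ whose last edge belongs to $A$ contains an edge of $C$ (edges of $A$ may be used in $C$); a minimum cut between $s$ and $A$ is one with the smallest number of edges. A minimum cut between $s$ and $A$ is primary if it is also a cut between $s$ and every minimum cut between $s$ and $A$ (such a minimum cut is unique). An edge subset $A$ is primary if $A$ is the primary minimum cut between $s$ and $A$ itself. $\mathscr{A}_r=\{A\subseteq E: A\text{ is primary and }|A|=r\}$. *)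

theory Defs
  imports
    "HOL-Probability.Probability"
    "Graph_Theory.Digraph"
    "Graph_Theory.Arc_Walk"
    "Jordan_Normal_Form.Matrix"
begin

locale network = fin_digraph G for G :: "('v, 'e) pre_digraph" +
  fixes s :: 'v and T :: "'v set"
  assumes acyclic_network: "acyclic (arcs_ends G)"
    and source_vert: "s \<in> verts G"
    and source_in: "in_arcs G s = {}"
    and sinks_nonempty: "T \<noteq> {}"
    and sinks_verts: "T \<subseteq> verts G - {s}"
    and sinks_out: "\<And>t. t \<in> T \<Longrightarrow> out_arcs G t = {}"

(* Imaginary i, for i < n, is the imaginary edge d_(i+1) entering the source. *)
datatype 'e in_edge = Imaginary nat | Proper 'e

(* A family (K_v) of local encoding kernels: K v d e is the entry k_(d,e) of K_v.
   Only the entries with d in In(v) and e in Out(v) are ever used. *)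
type_synonym ('v, 'e, 'f) kernels = "'v \<Rightarrow> 'e in_edge \<Rightarrow> 'e \<Rightarrow> 'f"

context network
begin

definition In :: "nat \<Rightarrow> 'v \<Rightarrow> 'e in_edge set" where
  "In n v = (if v = s then Imaginary ` {..<n} else Proper ` in_arcs G v)"

definition intermediate_nodes :: "'v set" where
  "intermediate_nodes = verts G - ({s} \<union> T)"

subsection \<open>Cuts\<close>

(* The graph is acyclic, so that arc walks and directed paths coincide. *)

definition sink_cut :: "'v \<Rightarrow> 'e set \<Rightarrow> bool" where
  "sink_cut t C \<longleftrightarrow> C \<subseteq> arcs G \<and> (\<nexists>p. awalk s p t \<and> set p \<inter> C = {})"

definition min_cut_capacity :: "'v \<Rightarrow> nat" where
  "min_cut_capacity t = Min (card ` {C. sink_cut t C})"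

definition C_min :: nat where
  "C_min = Min (min_cut_capacity ` T)"

definition edge_cut :: "'e set \<Rightarrow> 'e set \<Rightarrow> bool" where
  "edge_cut A C \<longleftrightarrow> C \<subseteq> arcs G \<and>
     (\<forall>p v. awalk s p v \<and> p \<noteq> [] \<and> last p \<in> A \<longrightarrow> set p \<inter> C \<noteq> {})"

definition min_edge_cut :: "'e set \<Rightarrow> 'e set \<Rightarrow> bool" where
  "min_edge_cut A C \<longleftrightarrow> is_arg_min card (edge_cut A) C"

definition primary_min_cut :: "'e set \<Rightarrow> 'e set \<Rightarrow> bool" where
  "primary_min_cut A C \<longleftrightarrow> min_edge_cut A C \<and> (\<forall>D. min_edge_cut A D \<longrightarrow> edge_cut D C)"

definition primary_sets :: "nat \<Rightarrow> 'e set set" where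
  "primary_sets r = {A. A \<subseteq> arcs G \<and> primary_min_cut A A \<and> card A = r}"

subsection \<open>Linear network codes\<close>

function symbol ::
  "nat \<Rightarrow> ('v, 'e, 'f :: field) kernels \<Rightarrow> 'f Matrix.vec \<Rightarrow> 'e in_edge \<Rightarrow> 'f" where
  "symbol n K x (Imaginary i) = vec_index x i"
| "symbol n K x (Proper e) =
     (if e \<in> arcs G
      then \<Sum>d \<in> In n (tail G e). K (tail G e) d e * symbol n K x d
      else 0)"
  by pat_completeness auto
termination
proof (relation "Wellfounded.measure (\<lambda>(n, K, x, d). case d of Imaginary i \<Rightarrow> 0
      | Proper e \<Rightarrow> Suc (card {u. (u, tail G e) \<in> (arcs_ends G)\<^sup>+}))", simp, goal_cases)
  case (1 n K x e d)
  show ?case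
  proof (cases d)
    case (Imaginary i)
    then show ?thesis by simp
  next
    case (Proper a)
    have a: "a \<in> arcs G" "head G a = tail G e"
      using 1(2) Proper by (auto simp: In_def split: if_splits)
    have step: "(tail G a, tail G e) \<in> arcs_ends G"
      using a by (force simp: arcs_ends_conv)
    have "(arcs_ends G)\<^sup>+ \<subseteq> verts G \<times> verts G"
      by (rule trancl_subset_Sigma) (auto simp: arcs_ends_conv)
    then have "finite {u. (u, tail G e) \<in> (arcs_ends G)\<^sup>+}"
      by (auto intro: finite_subset[OF _ finite_verts])
    moreover have "{u. (u, tail G a) \<in> (arcs_ends G)\<^sup>+} \<subset> {u. (u, tail G e) \<in> (arcs_ends G)\<^sup>+}"
      using step acyclic_network by (auto simp: acyclic_def intro: trancl_into_trancl)
    ultimately show ?thesis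
      using Proper by (simp add: psubset_card_mono)
  qed
qed

(* Y_A, as a function of the message m and the key k. *)
definition symbols_on ::
  "nat \<Rightarrow> nat \<Rightarrow> ('v, 'e, 'f :: field) kernels \<Rightarrow> 'e set
     \<Rightarrow> 'f Matrix.vec \<times> 'f Matrix.vec \<Rightarrow> 'e \<Rightarrow> 'f" where
  "symbols_on \<omega> r K A = (\<lambda>(m, k). \<lambda>e\<in>A. symbol (\<omega> + r) K (m @\<^sub>v k) (Proper e))"

end

(* Uniform message and uniform key, independent of each other. *)
definition message_key_space ::
  "nat \<Rightarrow> nat \<Rightarrow> ('f :: {field, finite} Matrix.vec \<times> 'f Matrix.vec) measure" where
  "message_key_space \<omega> r =
     uniform_count_measure (carrier_vec \<omega>) \<Otimes>\<^sub>M uniform_count_measure (carrier_vec r)"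

lemma prob_space_message_key_space:
  "prob_space (message_key_space \<omega> r :: ('f :: {field, finite} Matrix.vec \<times> 'f Matrix.vec) measure)"
proof -
  have "finite (carrier_vec n :: 'f Matrix.vec set)" for n
  proof -
    have "carrier_vec n \<subseteq> (\<lambda>f. Matrix.vec n f) ` ({..<n} \<rightarrow>\<^sub>E (UNIV :: 'f set))"
    proof
      fix v :: "'f Matrix.vec"
      assume "v \<in> carrier_vec n"
      then have "v = Matrix.vec n (restrict (vec_index v) {..<n})"
        by (intro eq_vecI) auto
      moreover have "restrict (vec_index v) {..<n} \<in> {..<n} \<rightarrow>\<^sub>E (UNIV :: 'f set)"
        by (intro restrict_PiE_iff[THEN iffD2] ballI UNIV_I)
      ultimately show "v \<in> (\<lambda>f. Matrix.vec n f) ` ({..<n} \<rightarrow>\<^sub>E (UNIV :: 'f set))"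
        by blast
    qed
    then show ?thesis
      by (rule finite_subset) (intro finite_imageI finite_PiE; simp)
  qed
  moreover have "(carrier_vec n :: 'f Matrix.vec set) \<noteq> {}" for n
    using zero_carrier_vec by blast
  ultimately have P: "prob_space (uniform_count_measure (carrier_vec n :: 'f Matrix.vec set))" for n
    by (intro prob_space_uniform_count_measure)
  interpret A: prob_space "uniform_count_measure (carrier_vec \<omega> :: 'f Matrix.vec set)" by (rule P)
  interpret B: prob_space "uniform_count_measure (carrier_vec r :: 'f Matrix.vec set)" by (rule P)
  interpret pair_prob_space "uniform_count_measure (carrier_vec \<omega> :: 'f Matrix.vec set)"
    "uniform_count_measure (carrier_vec r :: 'f Matrix.vec set)" ..
  show ?thesis
    unfolding message_key_space_def by (rule P.prob_space_axioms)
qed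

(* Mutual information in bits of discrete random variables, each taking values in its range. *)
definition mutual_info :: "'a measure \<Rightarrow> ('a \<Rightarrow> 'b) \<Rightarrow> ('a \<Rightarrow> 'c) \<Rightarrow> real" where
  "mutual_info \<Omega> X Y =
     prob_space.mutual_information \<Omega> 2 (count_space (X ` space \<Omega>)) (count_space (Y ` space \<Omega>)) X Y"

context network
begin

definition decodable :: "nat \<Rightarrow> nat \<Rightarrow> ('v, 'e, 'f :: {field, finite}) kernels \<Rightarrow> bool" where
  "decodable \<omega> r K \<longleftrightarrow>
     (\<forall>t\<in>T. \<exists>D. \<forall>m\<in>carrier_vec \<omega>. \<forall>k\<in>carrier_vec r.
        D (symbols_on \<omega> r K (in_arcs G t) (m, k)) = m)"

definition secure :: "nat \<Rightarrow> nat \<Rightarrow> ('v, 'e, 'f :: {field, finite}) kernels \<Rightarrow> bool" where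
  "secure \<omega> r K \<longleftrightarrow>
     (\<forall>A. A \<subseteq> arcs G \<and> card A \<le> r \<longrightarrow>
        mutual_info (message_key_space \<omega> r) (symbols_on \<omega> r K A) fst = 0)"

definition SLNC :: "nat \<Rightarrow> nat \<Rightarrow> ('v, 'e, 'f :: {field, finite}) kernels \<Rightarrow> bool" where
  "SLNC \<omega> r K \<longleftrightarrow> decodable \<omega> r K \<and> secure \<omega> r K"

(* At an intermediate node v \<noteq> s the set In(v) does not depend on the dimension of the code. *)
definition local_encoding_preserving ::
  "'i set \<Rightarrow> ('i \<Rightarrow> ('v, 'e, 'f) kernels) \<Rightarrow> bool" where
  "local_encoding_preserving I \<K> \<longleftrightarrow>
     (\<forall>i\<in>I. \<forall>j\<in>I. \<forall>v\<in>intermediate_nodes. \<forall>d\<in>in_arcs G v. \<forall>e\<in>out_arcs G v.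
        \<K> i v (Proper d) e = \<K> j v (Proper d) e)"

end

end

(* A code of dimension C_min - r with security level r suffices: for smaller rates a part of the
   message is fixed to zero, which changes only the kernel at the source and keeps both decodability
   and security.

   A C_min-dimensional code that every sink decodes is built edge by edge in topological order.
   Instead of flows it maintains, for every sink t and every vertex set X containing t, that the rank
   of the processed symbols entering X plus the number of unprocessed edges crossing into X is at
   least C_min. By submodularity the sets on which a new edge could violate this have a largest
   member for each t, so each sink excludes one hyperplane of coefficients, and |T| < q hyperplanes
   do not cover the coefficient space.

   For security, every set of at most r edges lies behind a primary set of size r. Since
   |A_r| < q, there are r key directions that together with the inputs vanishing on D span
   the whole input space, for all D in A_r at once; then for every message some key makes all symbols
   on D vanish, and so the distribution of these symbols does not depend on the message. *)
theory Submission
  imports Defs "HOL-Library.Function_Algebras"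
begin

section \<open>Linear algebra over a finite field\<close>

text \<open>Vectors are total functions, so the theory of subspaces and spans applies without
  carrier sets; F_q^n appears below as the subspace \<open>coord_space n\<close>.\<close>

definition fscale :: "'f :: field \<Rightarrow> ('i \<Rightarrow> 'f) \<Rightarrow> 'i \<Rightarrow> 'f" (infixr \<open>*f\<close> 75) where
  "c *f x = (\<lambda>i. c * x i)"

lemma fscale_apply [simp]: "(c *f x) i = c * x i"
  by (simp add: fscale_def)

global_interpretation fun_vs: vector_space "(*f)"
  by unfold_locales (simp_all add: fun_eq_iff algebra_simps)

section \<open>Linear functionals and their common zeros\<close>

definition functional :: "(('i \<Rightarrow> 'f :: field) \<Rightarrow> 'f) \<Rightarrow> bool" where
  "functional g \<longleftrightarrow> (\<forall>x y. g (x + y) = g x + g y) \<and> (\<forall>c x. g (c *f x) = c * g x)"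

lemma functional_add: "functional g \<Longrightarrow> g (x + y) = g x + g y"
  and functional_scale: "functional g \<Longrightarrow> g (c *f x) = c * g x"
  by (simp_all add: functional_def)

lemma functional_0: "functional g \<Longrightarrow> g 0 = 0"
  using functional_scale[of g 0 0] by simp

lemma functional_diff: "functional g \<Longrightarrow> g (x - y) = g x - g y"
  using functional_add[of g "x - y" y] by simp

lemma functional_sum: "functional g \<Longrightarrow> g (\<Sum>j\<in>A. h j) = (\<Sum>j\<in>A. g (h j))"
  by (induction A rule: infinite_finite_induct) (simp_all add: functional_0 functional_add)

lemma functional_proj: "functional (\<lambda>x. x i)"
  by (simp add: functional_def)

lemma functional_combination:
  assumes "\<And>d. d \<in> D \<Longrightarrow> functional (g d)"
  shows "functional (\<lambda>x. \<Sum>d\<in>D. k d * g d x)"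
  using assms
  by (simp add: functional_def distrib_left sum.distrib sum_distrib_left mult.left_commute)

lemma subspace_common_zeros:
  assumes "fun_vs.subspace U" and "\<And>d. d \<in> D \<Longrightarrow> functional (g d)"
  shows "fun_vs.subspace {x \<in> U. \<forall>d\<in>D. g d x = 0}"
  using assms unfolding fun_vs.subspace_def
  by (auto simp: functional_add functional_scale functional_0)

text \<open>A counting form of rank-nullity: an element of \<open>U\<close> is recovered from its
  image and from its difference to a fixed representative of its fibre, and this difference lies in
  \<open>K\<close>.\<close>

lemma card_le_card_fibres:
  fixes U K :: "'a :: ab_group_add set"
  assumes "finite U" "finite K"
    and "\<And>a b. a \<in> U \<Longrightarrow> b \<in> U \<Longrightarrow> f a = f b \<Longrightarrow> a - b \<in> K"
  shows "card U \<le> card K * card (f ` U)"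
proof -
  define rep where "rep c = (SOME a. a \<in> U \<and> f a = c)" for c
  have rep: "rep (f a) \<in> U \<and> f (rep (f a)) = f a" if "a \<in> U" for a
    unfolding rep_def by (rule someI[of _ a]) (simp add: that)
  have "card U \<le> card (K \<times> f ` U)"
  proof (rule card_inj_on_le[of "\<lambda>a. (a - rep (f a), f a)"])
    show "inj_on (\<lambda>a. (a - rep (f a), f a)) U"
      by (auto intro!: inj_onI)
    show "(\<lambda>a. (a - rep (f a), f a)) ` U \<subseteq> K \<times> f ` U"
      using assms(3) rep by force
  qed (simp add: assms)
  then show ?thesis by (simp add: card_cartesian_product)
qed

text \<open>The dimension formula in terms of cardinalities: addition maps
  \<open>A \<times> B\<close> into \<open>D\<close>, and pairs with equal sums differ by some
  \<open>(x, - x)\<close> with \<open>x\<close> in \<open>A \<inter> B\<close>.\<close>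

lemma card_subspace_inter:
  assumes D: "fun_vs.subspace D" "finite D"
    and A: "fun_vs.subspace A" "A \<subseteq> D" and B: "fun_vs.subspace B" "B \<subseteq> D"
  shows "card A * card B \<le> card (A \<inter> B) * card D"
proof -
  have fin: "finite A" "finite B"
    using A B D finite_subset by blast+
  let ?K = "(\<lambda>x. (x, - x)) ` (A \<inter> B)"
  have "card (A \<times> B) \<le> card ?K * card ((\<lambda>(a, b). a + b) ` (A \<times> B))"
  proof (rule card_le_card_fibres)
    fix p p' assume "p \<in> A \<times> B" "p' \<in> A \<times> B" "(\<lambda>(a, b). a + b) p = (\<lambda>(a, b). a + b) p'"
    then obtain a b a' b' where *: "p = (a, b)" "p' = (a', b')" "a \<in> A" "a' \<in> A" "b \<in> B" "b' \<in> B"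
      "a + b = a' + b'" by auto
    have "b - b' = - (a - a')"
      using *(7) by (simp add: algebra_simps)
    moreover have "a - a' = b' - b"
      using *(7) by (simp add: algebra_simps)
    moreover have "a - a' \<in> A"
      using * A by (simp add: fun_vs.subspace_diff)
    moreover have "b' - b \<in> B"
      using * B by (simp add: fun_vs.subspace_diff)
    ultimately show "p - p' \<in> ?K"
      using * by (auto simp: image_iff)
  qed (use fin in auto)
  also have "card ?K = card (A \<inter> B)"
    by (rule card_image) (auto intro: inj_onI)
  also have "card ((\<lambda>(a, b). a + b) ` (A \<times> B)) \<le> card D"
    using A B D by (intro card_mono) (auto intro: fun_vs.subspace_add)
  finally show ?thesis
    by (simp add: card_cartesian_product)
qed

text \<open>Each element of the span has a unique form \<open>x + c *f v\<close> with
  \<open>x\<close> in \<open>U\<close>, because a nonzero multiple of \<open>v\<close> in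
  \<open>U\<close> would put \<open>v\<close> itself into \<open>U\<close>.\<close>

lemma card_span_insert:
  fixes U :: "('i \<Rightarrow> 'f :: {field, finite}) set"
  assumes U: "fun_vs.subspace U" "finite U" and v: "v \<notin> U"
  shows "finite (fun_vs.span (insert v U))"
    and "card (fun_vs.span (insert v U)) = CARD('f) * card U"
proof -
  have bij: "bij_betw (\<lambda>(c, x). x + c *f v) (UNIV \<times> U) (fun_vs.span (insert v U))"
  proof (rule bij_betwI')
    fix p p' :: "'f \<times> ('i \<Rightarrow> 'f)" assume *: "p \<in> UNIV \<times> U" "p' \<in> UNIV \<times> U"
    obtain c x c' x' where p: "p = (c, x)" "p' = (c', x')" by fastforce
    have "p = p'" if eq: "x + c *f v = x' + c' *f v"
    proof -
      have "x - x' = (c' - c) *f v"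
        using eq by (simp add: fun_eq_iff algebra_simps)
      moreover have "x - x' \<in> U"
        using * p U by (auto intro: fun_vs.subspace_diff)
      ultimately have "inverse (c' - c) *f ((c' - c) *f v) \<in> U"
        using U fun_vs.subspace_scale by metis
      then have "c' - c = 0"
        using v by (cases "c' - c = 0") (auto simp: fun_vs.scale_scale simp del: right_minus_eq)
      then show ?thesis using eq p by simp
    qed
    then show "((case p of (c, x) \<Rightarrow> x + c *f v) = (case p' of (c, x) \<Rightarrow> x + c *f v)) = (p = p')"
      using p by auto
  next
    fix p :: "'f \<times> ('i \<Rightarrow> 'f)" assume *: "p \<in> UNIV \<times> U"
    then show "(case p of (c, x) \<Rightarrow> x + c *f v) \<in> fun_vs.span (insert v U)"
      by (auto intro!: fun_vs.span_add fun_vs.span_scale intro: fun_vs.span_base)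
  next
    fix y assume "y \<in> fun_vs.span (insert v U)"
    then obtain c where "y - c *f v \<in> U"
      using U(1) by (auto simp: fun_vs.span_insert fun_vs.span_eq_iff[THEN iffD2])
    then show "\<exists>p\<in>UNIV \<times> U. y = (case p of (c, x) \<Rightarrow> x + c *f v)"
      by (intro bexI[of _ "(c, y - c *f v)"]) auto
  qed
  show "finite (fun_vs.span (insert v U))"
    using bij_betw_finite[OF bij] U by simp
  show "card (fun_vs.span (insert v U)) = CARD('f) * card U"
    using bij_betw_same_card[OF bij] by (simp add: card_cartesian_product)
qed

text \<open>A maximal subspace of \<open>U\<close> whose size is a power of q must be
  \<open>U\<close>, since adjoining a further vector multiplies the size by q. Hence subspaces of
  different sizes differ by a factor of at least q.\<close>

lemma card_subspace_power:
  fixes U :: "('i \<Rightarrow> 'f :: {field, finite}) set"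
  assumes U: "fun_vs.subspace U" "finite U"
  obtains k where "card U = CARD('f) ^ k"
proof -
  let ?S = "{W. W \<subseteq> U \<and> fun_vs.subspace W \<and> (\<exists>k. card W = CARD('f) ^ k)}"
  have "card {0 :: 'i \<Rightarrow> 'f} = CARD('f) ^ 0" by simp
  then have "{0} \<in> ?S"
    using U by (auto simp: fun_vs.subspace_0 simp del: power_0)
  then have ne: "?S \<noteq> {}" by (metis (no_types) empty_iff)
  have "finite ?S"
    using U by (auto intro: finite_subset[of _ "Pow U"])
  from finite_has_maximal[OF this ne]
  obtain W where "W \<in> ?S" and max: "\<forall>W'\<in>?S. W \<subseteq> W' \<longrightarrow> W = W'"
    by (rule bexE)
  then obtain k where W: "W \<subseteq> U" "fun_vs.subspace W" "card W = CARD('f) ^ k" by auto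
  have "W = U"
  proof (rule ccontr)
    assume "W \<noteq> U"
    then obtain v where v: "v \<in> U" "v \<notin> W" using W by blast
    have "fun_vs.span (insert v W) \<subseteq> U"
      using W v U by (intro fun_vs.span_minimal) auto
    moreover have "card (fun_vs.span (insert v W)) = CARD('f) ^ Suc k"
      using card_span_insert(2)[OF W(2) finite_subset[OF W(1) U(2)] v(2)] W(3) by simp
    moreover have "W \<subseteq> fun_vs.span (insert v W)"
      by (auto intro: fun_vs.span_base)
    ultimately have "W = fun_vs.span (insert v W)"
      by (intro max[rule_format]) (auto simp del: power_Suc)
    then show False using v fun_vs.span_base by blast
  qed
  with W that show ?thesis by blast
qed

lemma card_field_gt_1: "1 < CARD('f :: {field, finite})"
proof -
  have "card {0, 1 :: 'f} \<le> CARD('f)" by (rule card_mono) auto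
  then show ?thesis by simp
qed

text \<open>The vector \<open>z\<close> lies outside the kernel, so adjoining it gives a subspace of
  \<open>U\<close> that is q times as large as the kernel.\<close>

lemma card_kernel:
  fixes U :: "('i \<Rightarrow> 'f :: {field, finite}) set"
  assumes U: "fun_vs.subspace U" "finite U" and g: "functional g" and z: "z \<in> U" "g z \<noteq> 0"
  shows "CARD('f) * card {x \<in> U. g x = 0} \<le> card U"
proof -
  let ?K = "{x \<in> U. g x = 0}"
  have K: "fun_vs.subspace ?K" "finite ?K"
    using subspace_common_zeros[of U UNIV "\<lambda>_. g"] U g by auto
  have "fun_vs.span (insert z ?K) \<subseteq> U"
    using U z by (intro fun_vs.span_minimal) auto
  then have "card (fun_vs.span (insert z ?K)) \<le> card U"
    using U by (intro card_mono)
  then show ?thesis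
    using card_span_insert(2)[OF K, of z] z by simp
qed

text \<open>A point outside all but one of the subspaces is moved along a line with q points; each
  subspace meets that line in at most one point.\<close>

lemma subspace_cover:
  fixes V :: "('i \<Rightarrow> 'f :: {field, finite}) set"
  assumes V: "fun_vs.subspace V" and "finite I" and "card I < CARD('f)"
    and "\<And>i. i \<in> I \<Longrightarrow> fun_vs.subspace (W i) \<and> \<not> V \<subseteq> W i"
  shows "\<exists>x\<in>V. \<forall>i\<in>I. x \<notin> W i"
  using assms(2-)
proof (induction I rule: finite_induct)
  case empty
  then show ?case using fun_vs.subspace_0[OF V] by blast
next
  case (insert i I)
  then obtain x where x: "x \<in> V" "\<And>j. j \<in> I \<Longrightarrow> x \<notin> W j" by force
  show ?case
  proof (cases "x \<in> W i")
    case False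
    then show ?thesis using x by blast
  next
    case True
    obtain y where y: "y \<in> V" "y \<notin> W i" using insert.prems by blast
    \<comment> \<open>On the line through \<open>x\<close> in direction \<open>y\<close>,
      \<open>W i\<close> rules out only the parameter 0. Every other \<open>W j\<close> rules out at
      most one parameter, since two of its points would put \<open>y\<close>, and then
      \<open>x\<close>, into \<open>W j\<close>.\<close>
    let ?bad = "\<lambda>j. {c. c *f y + x \<in> W j}"
    have bad: "card (?bad j) \<le> 1" if "j \<in> I" for j
    proof (rule ccontr)
      assume "\<not> ?thesis"
      then obtain c c' where c: "c \<noteq> c'" "c *f y + x \<in> W j" "c' *f y + x \<in> W j"
        using card_le_Suc0_iff_eq[of "?bad j"] by auto
      have W: "fun_vs.subspace (W j)" using insert.prems that by blast
      have "(c - c') *f y \<in> W j"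
        using fun_vs.subspace_diff[OF W c(2,3)] by (simp add: fun_vs.scale_left_diff_distrib)
      then have "inverse (c - c') *f ((c - c') *f y) \<in> W j"
        using W fun_vs.subspace_scale by blast
      then have "y \<in> W j" using c by (simp add: fun_vs.scale_scale)
      then have "(c *f y + x) - c *f y \<in> W j"
        using W c fun_vs.subspace_scale fun_vs.subspace_diff by blast
      then show False using x that by simp
    qed
    have "card (insert 0 (\<Union>j\<in>I. ?bad j)) \<le> Suc (\<Sum>j\<in>I. card (?bad j))"
      using insert.hyps by (intro order_trans[OF card_insert_le_m1]) (auto intro: card_UN_le)
    also have "\<dots> \<le> Suc (card I)"
      using sum_mono[of I "\<lambda>j. card (?bad j)" "\<lambda>_. 1"] bad by auto
    also have "\<dots> < CARD('f)"
      using insert by simp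
    finally have "insert 0 (\<Union>j\<in>I. ?bad j) \<noteq> UNIV"
      by force
    then obtain c where c: "c \<noteq> 0" "\<And>j. j \<in> I \<Longrightarrow> c *f y + x \<notin> W j" by auto
    have "c *f y + x \<notin> W i"
    proof
      assume *: "c *f y + x \<in> W i"
      have W: "fun_vs.subspace (W i)" using insert.prems by blast
      have "inverse c *f ((c *f y + x) - x) \<in> W i"
        using W * True fun_vs.subspace_scale fun_vs.subspace_diff by blast
      then show False using y c by (simp add: fun_vs.scale_scale)
    qed
    moreover have "c *f y + x \<in> V"
      using V x y by (simp add: fun_vs.subspace_add fun_vs.subspace_scale)
    ultimately show ?thesis using c by blast
  qed
qed

section \<open>Coordinate spaces and the choice of vectors in them\<close>

definition coord_space :: "nat \<Rightarrow> (nat \<Rightarrow> 'f :: field) set" where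
  "coord_space n = {x. \<forall>i\<ge>n. x i = 0}"

lemma subspace_coord_space: "fun_vs.subspace (coord_space n)"
  by (simp add: fun_vs.subspace_def coord_space_def)

lemma finite_coord_space [simp]: "finite (coord_space n :: (nat \<Rightarrow> 'f :: {field, finite}) set)"
  and card_coord_space: "card (coord_space n :: (nat \<Rightarrow> 'f) set) = CARD('f) ^ n"
proof -
  have eq: "coord_space n = PiE_dflt {..<n} 0 (\<lambda>_. UNIV :: 'f set)"
    by (auto simp: coord_space_def PiE_dflt_def not_less)
  show "finite (coord_space n :: (nat \<Rightarrow> 'f) set)"
    unfolding eq by (rule finite_PiE_dflt) auto
  show "card (coord_space n :: (nat \<Rightarrow> 'f) set) = CARD('f) ^ n"
    unfolding eq by (subst card_PiE_dflt) auto
qed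

text \<open>Inputs with equal values under all \<open>g d\<close> differ by a common zero, and there
  are at most \<open>CARD('f) ^ card D\<close> value tuples. So each equation costs at most one
  dimension.\<close>

lemma card_zeros_ge:
  fixes g :: "'d \<Rightarrow> (nat \<Rightarrow> 'f :: {field, finite}) \<Rightarrow> 'f"
  assumes D: "finite D" and g: "\<And>d. d \<in> D \<Longrightarrow> functional (g d)"
  shows "CARD('f) ^ n \<le> card {x \<in> coord_space n. \<forall>d\<in>D. g d x = 0} * CARD('f) ^ card D"
proof -
  let ?f = "\<lambda>x. \<lambda>d\<in>D. g d x"
  have "card (coord_space n :: (nat \<Rightarrow> 'f) set)
      \<le> card {x \<in> coord_space n. \<forall>d\<in>D. g d x = 0} * card (?f ` coord_space n)"
  proof (rule card_le_card_fibres)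
    fix a b :: "nat \<Rightarrow> 'f" assume ab: "a \<in> coord_space n" "b \<in> coord_space n" and eq: "?f a = ?f b"
    have "g d (a - b) = 0" if "d \<in> D" for d
      using fun_cong[OF eq, of d] g that by (simp add: functional_diff)
    then show "a - b \<in> {x \<in> coord_space n. \<forall>d\<in>D. g d x = 0}"
      using ab fun_vs.subspace_diff[OF subspace_coord_space] by blast
  qed auto
  also have "card (?f ` coord_space n) \<le> card (D \<rightarrow>\<^sub>E (UNIV :: 'f set))"
    by (intro card_mono finite_PiE) (auto simp: D)
  also have "\<dots> = CARD('f) ^ card D"
    using D by (simp add: card_PiE)
  finally show ?thesis by (simp add: card_coord_space)
qed

text \<open>The hypothesis says that each \<open>Z i\<close> has codimension at most
  \<open>r\<close>. A vector outside all proper \<open>Z i\<close> is adjoined to every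
  \<open>Z i\<close> at once, which lowers each positive codimension by one; after \<open>r\<close>
  rounds only the whole space is left.\<close>

lemma simultaneous_complement:
  fixes Z :: "'i \<Rightarrow> (nat \<Rightarrow> 'f :: {field, finite}) set"
  assumes "finite I" "card I < CARD('f)"
    and "\<And>i. i \<in> I \<Longrightarrow> fun_vs.subspace (Z i) \<and> Z i \<subseteq> coord_space n
           \<and> CARD('f) ^ n \<le> card (Z i) * CARD('f) ^ r"
  shows "\<exists>V. (\<forall>j<r. V j \<in> coord_space n) \<and>
           (\<forall>i\<in>I. \<forall>x\<in>coord_space n. \<exists>k. x - (\<Sum>j<r. k j *f V j) \<in> Z i)"
  using assms(3)
proof (induction r arbitrary: Z)
  case 0
  have "Z i = coord_space n" if "i \<in> I" for i
    using 0[OF that] by (intro card_seteq) (auto simp: card_coord_space)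
  then show ?case by simp
next
  case (Suc r)
  let ?E = "coord_space n :: (nat \<Rightarrow> 'f) set"
  \<comment> \<open>Spaces that are already full are left out, since no vector avoids them.\<close>
  let ?J = "{i \<in> I. Z i \<noteq> ?E}"
  have "\<exists>v\<in>?E. \<forall>i\<in>?J. v \<notin> Z i"
  proof (rule subspace_cover[OF subspace_coord_space])
    show "card ?J < CARD('f)"
      using card_mono[of I ?J] assms(1,2) by force
    show "fun_vs.subspace (Z i) \<and> \<not> ?E \<subseteq> Z i" if "i \<in> ?J" for i
      using Suc.prems that by blast
  qed (simp add: assms)
  then obtain v where v: "v \<in> ?E" "\<And>i. i \<in> I \<Longrightarrow> Z i \<noteq> ?E \<Longrightarrow> v \<notin> Z i" by blast
  define Z' where "Z' i = fun_vs.span (insert v (Z i))" for i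
  have "fun_vs.subspace (Z' i) \<and> Z' i \<subseteq> ?E \<and> CARD('f) ^ n \<le> card (Z' i) * CARD('f) ^ r"
    if i: "i \<in> I" for i
  proof -
    have sub: "Z' i \<subseteq> ?E"
      unfolding Z'_def using Suc.prems[OF i] v
      by (intro fun_vs.span_minimal subspace_coord_space) auto
    have fin: "finite (Z i)"
      using Suc.prems[OF i] by (blast intro: finite_subset[OF _ finite_coord_space])
    have "CARD('f) ^ n \<le> card (Z' i) * CARD('f) ^ r"
    proof (cases "Z i = ?E")
      case True
      then have "Z' i = ?E"
        using sub unfolding Z'_def by (auto intro: fun_vs.span_base)
      then show ?thesis by (simp add: card_coord_space)
    next
      case False
      then show ?thesis
        using card_span_insert(2)[of "Z i" v] Suc.prems[OF i] v(2)[OF i] fin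
        by (simp add: Z'_def mult_ac)
    qed
    then show ?thesis using sub by (simp add: Z'_def)
  qed
  from Suc.IH[of Z', OF this] obtain V where V: "\<And>j. j < r \<Longrightarrow> V j \<in> ?E"
    "\<And>i x. i \<in> I \<Longrightarrow> x \<in> ?E \<Longrightarrow> \<exists>k. x - (\<Sum>j<r. k j *f V j) \<in> Z' i" by blast
  have sub: "fun_vs.subspace (Z i)" if "i \<in> I" for i
    using Suc.prems[OF that] by blast
  have main: "\<exists>k. x - (\<Sum>j<Suc r. k j *f (V(r := v)) j) \<in> Z i" if i: "i \<in> I" "x \<in> ?E" for i x
  proof -
    obtain k where k: "x - (\<Sum>j<r. k j *f V j) \<in> Z' i" using V(2)[OF i] ..
    have "\<exists>c. x - (\<Sum>j<r. k j *f V j) - c *f v \<in> Z i"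
      using k unfolding Z'_def fun_vs.span_insert fun_vs.span_eq_iff[THEN iffD2, OF sub[OF i(1)]]
        mem_Collect_eq .
    then obtain c where c: "x - (\<Sum>j<r. k j *f V j) - c *f v \<in> Z i" ..
    have "(\<Sum>j<r. (k(r := c)) j *f (V(r := v)) j) = (\<Sum>j<r. k j *f V j)"
      by (rule sum.cong) auto
    then have "(\<Sum>j<Suc r. (k(r := c)) j *f (V(r := v)) j) = (\<Sum>j<r. k j *f V j) + c *f v"
      by simp
    then show ?thesis
      using c by (intro exI[of _ "k(r := c)"]) (simp only: diff_diff_eq)
  qed
  have "\<forall>j<Suc r. (V(r := v)) j \<in> coord_space n"
    using V(1) v(1) by (simp add: less_Suc_eq)
  with main show ?case
    by (intro exI[of _ "V(r := v)"]) blast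
qed

text \<open>The given \<open>V j\<close> may be dependent, so only the coefficients from
  \<open>r\<close> on are forced to vanish; these will carry the message. Each new vector is taken
  outside the at most q^n combinations of the first \<open>n\<close> vectors, which is possible
  while \<open>n < N\<close>.\<close>

lemma extend_independently:
  fixes V :: "nat \<Rightarrow> nat \<Rightarrow> 'f :: {field, finite}"
  assumes "\<And>j. j < r \<Longrightarrow> V j \<in> coord_space N" and "r \<le> n" "n \<le> N"
  shows "\<exists>u. (\<forall>j<r. u j = V j) \<and> (\<forall>j<n. u j \<in> coord_space N) \<and>
           (\<forall>c. (\<Sum>j<n. c j *f u j) = 0 \<longrightarrow> (\<forall>j. r \<le> j \<and> j < n \<longrightarrow> c j = 0))"
  using assms(2,3)
proof (induction n rule: dec_induct)
  case base
  then show ?case using assms(1) by (intro exI[of _ V]) auto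
next
  case (step n)
  have "\<exists>u. (\<forall>j<r. u j = V j) \<and> (\<forall>j<n. u j \<in> coord_space N) \<and>
      (\<forall>c. (\<Sum>j<n. c j *f u j) = 0 \<longrightarrow> (\<forall>j. r \<le> j \<and> j < n \<longrightarrow> c j = 0))"
    by (rule step.IH) (use step.prems in simp)
  then obtain u where u: "\<And>j. j < r \<Longrightarrow> u j = V j" "\<And>j. j < n \<Longrightarrow> u j \<in> coord_space N"
    and indep: "\<And>c. (\<Sum>j<n. c j *f u j) = 0 \<longrightarrow> (\<forall>j. r \<le> j \<and> j < n \<longrightarrow> c j = 0)"
    by blast
  let ?S = "(\<lambda>c. \<Sum>j<n. c j *f u j) ` ({..<n} \<rightarrow>\<^sub>E (UNIV :: 'f set))"
  have "card ?S \<le> card ({..<n} \<rightarrow>\<^sub>E (UNIV :: 'f set))"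
    by (intro card_image_le finite_PiE) auto
  also have "\<dots> = CARD('f) ^ n" by (simp add: card_PiE)
  also have "\<dots> < CARD('f) ^ N"
    using step card_field_gt_1[where ?'f = 'f] by (intro power_strict_increasing) auto
  also have "\<dots> = card (coord_space N :: (nat \<Rightarrow> 'f) set)" by (simp add: card_coord_space)
  finally have less: "card ?S < card (coord_space N :: (nat \<Rightarrow> 'f) set)" .
  have "finite ?S" by (intro finite_imageI finite_PiE) auto
  with less have "\<not> coord_space N \<subseteq> ?S"
    by (meson card_mono not_le)
  then obtain b where b: "b \<in> coord_space N" "b \<notin> ?S" by blast
  have b': "b \<noteq> (\<Sum>j<n. c j *f u j)" for c
  proof -
    have "(\<Sum>j<n. c j *f u j) = (\<Sum>j<n. restrict c {..<n} j *f u j)" by (intro sum.cong) auto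
    then have "(\<Sum>j<n. c j *f u j) \<in> ?S"
      by (rule image_eqI[of _ _ "restrict c {..<n}"]) auto
    with b(2) show ?thesis by auto
  qed
  have main: "c j = 0" if c: "(\<Sum>j<Suc n. c j *f (u(n := b)) j) = 0" and j: "r \<le> j" "j < Suc n" for c j
  proof -
    have "(\<Sum>j<n. c j *f (u(n := b)) j) = (\<Sum>j<n. c j *f u j)"
      by (rule sum.cong) auto
    then have eq: "(\<Sum>j<n. c j *f u j) + c n *f b = 0"
      using c by simp
    have "c n = 0"
    proof (rule ccontr)
      assume nz: "c n \<noteq> 0"
      have "(- inverse (c n)) *f ((\<Sum>j<n. c j *f u j) + c n *f b) = 0"
        using eq by simp
      then have "b = (- inverse (c n)) *f (\<Sum>j<n. c j *f u j)"
        using nz by (simp add: fun_vs.scale_right_distrib fun_vs.scale_scale)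
      also have "\<dots> = (\<Sum>j<n. (- inverse (c n) * c j) *f u j)"
        by (simp add: fun_vs.scale_sum_right fun_vs.scale_scale)
      finally show False using b'[of "\<lambda>j. - inverse (c n) * c j"] by blast
    qed
    then show ?thesis using eq indep[of c] j by (auto simp: less_Suc_eq)
  qed
  have "\<forall>j<r. (u(n := b)) j = V j" "\<forall>j<Suc n. (u(n := b)) j \<in> coord_space N"
    using u b(1) step.hyps by (simp_all add: less_Suc_eq)
  with main show ?case
    by (intro exI[of _ "u(n := b)"]) blast
qed

section \<open>Independence of the message\<close>

lemma sum_lessThan_add:
  "(\<Sum>i<a + b. f i) = (\<Sum>i<a. f i) + (\<Sum>j<b. f (a + j :: nat))" for f :: "nat \<Rightarrow> 'a :: comm_monoid_add"
  by (induction b) (simp_all add: add.assoc)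

lemma finite_carrier_vec: "finite (carrier_vec n :: 'f :: {field, finite} Matrix.vec set)"
proof (rule finite_subset)
  show "carrier_vec n \<subseteq> (\<lambda>x. Matrix.vec n x) ` (coord_space n :: (nat \<Rightarrow> 'f) set)"
  proof
    fix v :: "'f Matrix.vec" assume v: "v \<in> carrier_vec n"
    then have "v = Matrix.vec n (\<lambda>i. if i < n then v $ i else 0)"
      by (intro eq_vecI) auto
    moreover have "(\<lambda>i. if i < n then v $ i else 0) \<in> coord_space n"
      by (simp add: coord_space_def)
    ultimately show "v \<in> (\<lambda>x. Matrix.vec n x) ` (coord_space n :: (nat \<Rightarrow> 'f) set)"
      by (rule image_eqI)
  qed
qed simp

text \<open>Singletons have the same mass on both sides. Probabilities on the product can then be
  computed by counting pairs.\<close>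

lemma uniform_count_measure_Times:
  assumes A: "finite A" "A \<noteq> {}" and B: "finite B" "B \<noteq> {}"
  shows "uniform_count_measure A \<Otimes>\<^sub>M uniform_count_measure B = uniform_count_measure (A \<times> B)"
proof (rule measure_eqI_finite)
  interpret A: prob_space "uniform_count_measure A" by (rule prob_space_uniform_count_measure[OF A])
  interpret B: prob_space "uniform_count_measure B" by (rule prob_space_uniform_count_measure[OF B])
  have "sets (uniform_count_measure A \<Otimes>\<^sub>M uniform_count_measure B) = sets (count_space A \<Otimes>\<^sub>M count_space B)"
    by (intro sets_pair_measure_cong sets_uniform_count_measure_count_space)
  also have "\<dots> = Pow (A \<times> B)"
    using A B by (subst pair_measure_countable) (auto intro: countable_finite)
  finally show "sets (uniform_count_measure A \<Otimes>\<^sub>M uniform_count_measure B) = Pow (A \<times> B)" .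
  show "emeasure (uniform_count_measure A \<Otimes>\<^sub>M uniform_count_measure B) {p}
      = emeasure (uniform_count_measure (A \<times> B)) {p}" if pm: "p \<in> A \<times> B" for p
  proof -
    obtain a b where p: "p = (a, b)" "a \<in> A" "b \<in> B" using pm by blast
    have "emeasure (uniform_count_measure A \<Otimes>\<^sub>M uniform_count_measure B) ({a} \<times> {b})
        = ennreal (1 / card A) * ennreal (1 / card B)"
      using p A B by (subst B.emeasure_pair_measure_Times)
        (auto simp: sets_uniform_count_measure emeasure_uniform_count_measure)
    also have "\<dots> = ennreal (1 / card (A \<times> B))"
      by (simp add: ennreal_mult[symmetric] card_cartesian_product)
    finally show ?thesis
      using p A B by (simp add: emeasure_uniform_count_measure)
  qed
qed (use A B in \<open>auto simp: sets_uniform_count_measure\<close>)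

text \<open>The number of \<open>b\<close> that produce \<open>c\<close> is the same for every
  \<open>a\<close>, so the joint law of \<open>X\<close> and \<open>fst\<close> is the product of
  the marginals. Mutual information is the divergence between these two laws.\<close>

lemma mutual_info_fst_eq_0:
  assumes A: "finite A" "A \<noteq> {}" and B: "finite B" "B \<noteq> {}"
    and fibres: "\<And>a c. a \<in> A \<Longrightarrow> card {b \<in> B. X (a, b) = c} = n c"
  shows "mutual_info (uniform_count_measure A \<Otimes>\<^sub>M uniform_count_measure B) X fst = 0"
proof -
  note fst_image_times [simp del]
  let ?M = "uniform_count_measure (A \<times> B)"
  let ?S = "count_space (X ` (A \<times> B))" and ?T = "count_space (A)"
  interpret prob_space ?M using A B by (intro prob_space_uniform_count_measure) auto
  have space: "space ?M = A \<times> B" by (simp add: space_uniform_count_measure)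
  have img: "fst ` (A \<times> B) = A" using B by force
  have [measurable]: "X \<in> measurable ?M ?S" "fst \<in> measurable ?M ?T"
    by (auto simp: measurable_def space sets_uniform_count_measure)
  have prob: "emeasure ?M Q = ennreal (card Q / (card A * card B))" if "Q \<subseteq> A \<times> B" for Q
    using that A B by (simp add: emeasure_uniform_count_measure card_cartesian_product)
  have pos: "card A > 0" "card B > 0" using A B by (simp_all add: card_gt_0_iff)
  have ST: "?S \<Otimes>\<^sub>M ?T = count_space (X ` (A \<times> B) \<times> A)"
    using A B by (intro pair_measure_countable countable_finite) auto
  interpret D1: prob_space "distr ?M ?S X" by (rule prob_space_distr) simp
  interpret D2: prob_space "distr ?M ?T fst" by (rule prob_space_distr) simp
  have eq: "distr ?M ?S X \<Otimes>\<^sub>M distr ?M ?T fst = distr ?M (?S \<Otimes>\<^sub>M ?T) (\<lambda>p. (X p, fst p))"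
  proof (rule measure_eqI_finite)
    have "sets (distr ?M ?S X \<Otimes>\<^sub>M distr ?M ?T fst) = sets (?S \<Otimes>\<^sub>M ?T)"
      by (intro sets_pair_measure_cong) simp_all
    also have "\<dots> = Pow (X ` (A \<times> B) \<times> A)"
      unfolding ST by simp
    finally show "sets (distr ?M ?S X \<Otimes>\<^sub>M distr ?M ?T fst) = Pow (X ` (A \<times> B) \<times> A)" .
    show "sets (distr ?M (?S \<Otimes>\<^sub>M ?T) (\<lambda>p. (X p, fst p))) = Pow (X ` (A \<times> B) \<times> A)"
      unfolding ST by simp
    show "finite (X ` (A \<times> B) \<times> A)" using A B by auto
    fix p assume "p \<in> X ` (A \<times> B) \<times> A"
    then obtain c a where p: "p = (c, a)" "c \<in> X ` (A \<times> B)" "a \<in> A" by blast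
    have card1: "card {q \<in> A \<times> B. X q = c} = card A * n c"
    proof -
      have "{q \<in> A \<times> B. X q = c} = Sigma A (\<lambda>a. {b \<in> B. X (a, b) = c})" by auto
      then show ?thesis using A B fibres by (simp add: card_SigmaI)
    qed
    have card2: "card {q \<in> A \<times> B. fst q = a} = card B"
    proof -
      have "{q \<in> A \<times> B. fst q = a} = {a} \<times> B" using p by auto
      then show ?thesis by (simp add: card_cartesian_product)
    qed
    have card3: "card {q \<in> A \<times> B. X q = c \<and> fst q = a} = n c"
    proof -
      have "{q \<in> A \<times> B. X q = c \<and> fst q = a} = {a} \<times> {b \<in> B. X (a, b) = c}" using p by auto
      then show ?thesis using fibres[OF p(3)] by (simp add: card_cartesian_product)
    qed
    have "emeasure (distr ?M ?S X) {c} = emeasure ?M {q \<in> A \<times> B. X q = c}"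
      using p by (subst emeasure_distr) (auto simp: space intro!: arg_cong[where f = "emeasure ?M"])
    also have "\<dots> = ennreal (n c / card B)"
      using pos by (subst prob) (auto simp: card1)
    finally have 1: "emeasure (distr ?M ?S X) {c} = ennreal (n c / card B)" .
    have "emeasure (distr ?M ?T fst) {a} = emeasure ?M {q \<in> A \<times> B. fst q = a}"
      using p by (subst emeasure_distr) (auto simp: space intro!: arg_cong[where f = "emeasure ?M"])
    also have "\<dots> = ennreal (1 / card A)"
      using pos by (subst prob) (auto simp: card2)
    finally have 2: "emeasure (distr ?M ?T fst) {a} = ennreal (1 / card A)" .
    have "emeasure (distr ?M ?S X \<Otimes>\<^sub>M distr ?M ?T fst) ({c} \<times> {a}) = ennreal (n c / card B) * ennreal (1 / card A)"
      unfolding 1[symmetric] 2[symmetric]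
      using p by (intro D2.emeasure_pair_measure_Times) auto
    also have "\<dots> = ennreal (n c / (card A * card B))"
      by (simp add: ennreal_mult[symmetric] mult.commute)
    also have "\<dots> = emeasure ?M {q \<in> A \<times> B. X q = c \<and> fst q = a}"
      by (subst prob) (auto simp: card3)
    also have "\<dots> = emeasure (distr ?M (?S \<Otimes>\<^sub>M ?T) (\<lambda>p. (X p, fst p))) ({c} \<times> {a})"
    proof (subst emeasure_distr)
      show "{c} \<times> {a} \<in> sets (?S \<Otimes>\<^sub>M ?T)" unfolding ST using p by simp
    qed (measurable, auto simp: space intro!: arg_cong[where f = "emeasure ?M"])
    finally show "emeasure (distr ?M ?S X \<Otimes>\<^sub>M distr ?M ?T fst) {p}
        = emeasure (distr ?M (?S \<Otimes>\<^sub>M ?T) (\<lambda>p. (X p, fst p))) {p}"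
      using p by simp
  qed
  interpret J: prob_space "distr ?M (?S \<Otimes>\<^sub>M ?T) (\<lambda>p. (X p, fst p))"
    by (rule prob_space_distr) measurable
  have "mutual_information 2 ?S ?T X fst = 0"
    unfolding mutual_information_def eq by (rule J.KL_same_eq_0)
  then show ?thesis
    by (simp add: mutual_info_def uniform_count_measure_Times[OF A B] space img)
qed

section \<open>Primary edge sets\<close>

context network
begin

section \<open>Cuts between the source and sets of edges\<close>

lemma awalk_prefix: "awalk u (xs @ d # ys) v \<Longrightarrow> awalk u (xs @ [d]) (head G d)"
  by (auto simp: awalk_append_iff awalk_Cons_iff awalk_Nil_iff)

lemma edge_cut_subset: "edge_cut A C \<Longrightarrow> C \<subseteq> arcs G"
  by (simp add: edge_cut_def)

lemma edge_cut_refl: "A \<subseteq> arcs G \<Longrightarrow> edge_cut A A"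
  by (auto simp: edge_cut_def dest: last_in_set)

lemma edge_cut_mono: "edge_cut A C \<Longrightarrow> B \<subseteq> A \<Longrightarrow> C \<subseteq> D \<Longrightarrow> D \<subseteq> arcs G \<Longrightarrow> edge_cut B D"
  unfolding edge_cut_def by blast

text \<open>A walk into \<open>A\<close> meets \<open>D\<close>; its prefix ending with that edge is
  a walk into \<open>D\<close> and therefore meets \<open>C\<close>.\<close>

lemma edge_cut_trans:
  assumes "edge_cut A D" "edge_cut D C"
  shows "edge_cut A C"
  unfolding edge_cut_def
proof (intro conjI allI impI)
  fix p v assume p: "awalk s p v \<and> p \<noteq> [] \<and> last p \<in> A"
  then obtain d where "d \<in> set p" "d \<in> D"
    using assms(1) unfolding edge_cut_def by blast
  then obtain xs ys where split: "p = xs @ d # ys"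
    by (meson split_list)
  with p have "awalk s (xs @ [d]) (head G d)"
    using awalk_prefix by blast
  then have "set (xs @ [d]) \<inter> C \<noteq> {}"
    using assms(2) \<open>d \<in> D\<close> unfolding edge_cut_def by (metis last_snoc snoc_eq_iff_butlast)
  then show "set p \<inter> C \<noteq> {}"
    using split by auto
qed (use assms in \<open>auto simp: edge_cut_def\<close>)

lemma min_edge_cut_iff:
  "min_edge_cut A C \<longleftrightarrow> edge_cut A C \<and> (\<forall>D. edge_cut A D \<longrightarrow> card C \<le> card D)"
  by (auto simp: min_edge_cut_def is_arg_min_def not_less)

lemma min_edge_cut_exists:
  assumes "A \<subseteq> arcs G"
  obtains C where "min_edge_cut A C"
  using ex_has_least_nat[of "edge_cut A" A card] edge_cut_refl[OF assms]
  unfolding min_edge_cut_iff by blast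

text \<open>The first edges of two minimum cuts met by walks from the source, and the last ones met by
  walks to \<open>A\<close>, again form cuts of \<open>A\<close>; an edge that is both lies in both minimum cuts.\<close>

lemma min_edge_cut_meet:
  assumes C: "min_edge_cut A C1" "min_edge_cut A C2"
  obtains C where "min_edge_cut A C" "edge_cut C1 C" "edge_cut C2 C"
proof -
  define U where "U = C1 \<union> C2"
  define F where "F = {e \<in> U. \<exists>p v. awalk s (p @ [e]) v \<and> set p \<inter> U = {}}"
  define L where "L = {e \<in> U. \<exists>q v. awalk (tail G e) (e # q) v \<and> last (e # q) \<in> A \<and> set q \<inter> U = {}}"
  have cuts: "edge_cut A C1" "edge_cut A C2"
    using C by (auto simp: min_edge_cut_iff)
  then have U: "U \<subseteq> arcs G" "finite U"
    unfolding U_def by (auto dest: edge_cut_subset intro: finite_subset[OF _ finite_arcs])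
  have AU: "edge_cut A U"
    by (rule edge_cut_mono[OF cuts(1) _ _ U(1)]) (auto simp: U_def)
  have UF: "edge_cut U F"
    unfolding edge_cut_def
  proof (intro conjI allI impI)
    fix p v assume p: "awalk s p v \<and> p \<noteq> [] \<and> last p \<in> U"
    then have "\<exists>e\<in>set p. e \<in> U" by (meson last_in_set)
    then obtain xs e ys where split: "p = xs @ e # ys" "e \<in> U" "\<forall>x\<in>set xs. x \<notin> U"
      using split_list_first_prop[of p "\<lambda>e. e \<in> U"] by blast
    then have "awalk s (xs @ [e]) (head G e)"
      using p awalk_prefix by blast
    then have "e \<in> F"
      unfolding F_def using split by blast
    then show "set p \<inter> F \<noteq> {}"
      using split by auto
  qed (use U in \<open>auto simp: F_def\<close>)
  have AL: "edge_cut A L"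
    unfolding edge_cut_def
  proof (intro conjI allI impI)
    fix p v assume p: "awalk s p v \<and> p \<noteq> [] \<and> last p \<in> A"
    then have "\<exists>e\<in>set p. e \<in> U" using AU unfolding edge_cut_def by blast
    then obtain xs e ys where split: "p = xs @ e # ys" "e \<in> U" "\<forall>y\<in>set ys. y \<notin> U"
      using split_list_last_prop[of p "\<lambda>e. e \<in> U"] by blast
    then have "awalk (tail G e) (e # ys) v"
      using p by (auto simp: awalk_append_iff awalk_Cons_iff)
    moreover have "last (e # ys) \<in> A"
      using p split by simp
    ultimately have "e \<in> L"
      unfolding L_def using split by blast
    then show "set p \<inter> L \<noteq> {}"
      using split by auto
  qed (use U in \<open>auto simp: L_def\<close>)
  have "F \<inter> L \<subseteq> C1 \<inter> C2"
  proof
    fix e assume e: "e \<in> F \<inter> L"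
    then obtain p v q w where p: "awalk s (p @ [e]) v" "set p \<inter> U = {}"
      and q: "awalk (tail G e) (e # q) w" "last (e # q) \<in> A" "set q \<inter> U = {}"
      unfolding F_def L_def by blast
    have walk: "awalk s (p @ e # q) w"
      using p q by (auto simp: awalk_append_iff awalk_Cons_iff)
    have "set (p @ e # q) \<inter> C1 \<noteq> {}" "set (p @ e # q) \<inter> C2 \<noteq> {}"
      using cuts walk q(2) unfolding edge_cut_def by (metis append_is_Nil_conv last_appendR list.distinct(1))+
    then show "e \<in> C1 \<inter> C2"
      using p(2) q(3) unfolding U_def by auto
  qed
  then have "card (F \<inter> L) \<le> card (C1 \<inter> C2)"
    using U by (intro card_mono) (auto simp: U_def)
  moreover have "card (F \<union> L) \<le> card U"
    using U by (intro card_mono) (auto simp: F_def L_def)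
  moreover have "finite F" "finite L" "finite C1" "finite C2"
    using U by (auto simp: F_def L_def U_def)
  ultimately have "card F + card L \<le> card C1 + card C2"
    using card_Un_Int[of F L] card_Un_Int[of C1 C2] by (simp add: U_def)
  \<comment> \<open>\<open>L\<close> cuts \<open>A\<close> and so is no smaller than the minimum cut
    \<open>C2\<close>; the bound on the sum then leaves at most \<open>card C1\<close> edges for
    \<open>F\<close>.\<close>
  moreover have "card C2 \<le> card L"
    using C AL by (simp add: min_edge_cut_iff)
  ultimately have "card F \<le> card C1" by simp
  then have "min_edge_cut A F"
    using C(1) edge_cut_trans[OF AU UF] unfolding min_edge_cut_iff by (meson order_trans)
  moreover have "edge_cut C1 F" "edge_cut C2 F"
    by (rule edge_cut_mono[OF UF _ subset_refl edge_cut_subset[OF UF]], simp add: U_def)+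
  ultimately show ?thesis by (rule that)
qed

text \<open>Pairwise meets are folded over the finite set of minimum cuts, which gives one that cuts
  all of them.\<close>

lemma primary_min_cut_exists:
  assumes A: "A \<subseteq> arcs G"
  obtains C where "primary_min_cut A C"
proof -
  let ?M = "{D. min_edge_cut A D}"
  have "?M \<subseteq> Pow (arcs G)"
    by (auto simp: min_edge_cut_iff dest: edge_cut_subset)
  then have fin: "finite ?M" by (rule finite_subset) simp
  have "\<exists>C. min_edge_cut A C \<and> (\<forall>D\<in>F. edge_cut D C)" if "finite F" "F \<subseteq> ?M" for F
    using that
  proof (induction F rule: finite_induct)
    case empty
    then show ?case using min_edge_cut_exists[OF A] by blast
  next
    case (insert D F)
    then obtain C where C: "min_edge_cut A C" "\<forall>D\<in>F. edge_cut D C" by blast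
    obtain C' where C': "min_edge_cut A C'" "edge_cut C C'" "edge_cut D C'"
      using min_edge_cut_meet[OF C(1), of D] insert.prems by blast
    then show ?case
      using C(2) edge_cut_trans by blast
  qed
  from this[OF fin subset_refl] show ?thesis
    using that unfolding primary_min_cut_def by blast
qed

text \<open>By transitivity every minimum cut of \<open>C\<close> is also a minimum cut of
  \<open>A\<close>, and \<open>C\<close> cuts all of those.\<close>

lemma primary_min_cut_primary:
  assumes C: "primary_min_cut A C"
  shows "primary_min_cut C C"
proof -
  have C': "edge_cut A C" "\<And>D. edge_cut A D \<Longrightarrow> card C \<le> card D"
    "\<And>D. min_edge_cut A D \<Longrightarrow> edge_cut D C"
    using C by (auto simp: primary_min_cut_def min_edge_cut_iff)
  have "min_edge_cut C C"
    unfolding min_edge_cut_iff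
    using C' edge_cut_trans edge_cut_refl edge_cut_subset by meson
  moreover have "edge_cut D C" if D: "min_edge_cut C D" for D
  proof (rule C'(3))
    have "edge_cut A D"
      using D C'(1) edge_cut_trans unfolding min_edge_cut_iff by blast
    moreover have "card D \<le> card C"
      using D edge_cut_refl[OF edge_cut_subset[OF C'(1)]] unfolding min_edge_cut_iff by blast
    ultimately show "min_edge_cut A D"
      using C'(2) unfolding min_edge_cut_iff by (meson order_trans)
  qed
  ultimately show ?thesis by (simp add: primary_min_cut_def)
qed

section \<open>Sizes of minimum cuts\<close>

definition cut_size :: "'e set \<Rightarrow> nat" where
  "cut_size A = (LEAST k. \<exists>C. edge_cut A C \<and> card C = k)"

lemma cut_size_le: "edge_cut A C \<Longrightarrow> cut_size A \<le> card C"
  unfolding cut_size_def by (rule Least_le) blast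

lemma cut_size_attained:
  assumes "A \<subseteq> arcs G"
  obtains C where "edge_cut A C" "card C = cut_size A"
  using LeastI[of "\<lambda>k. \<exists>C. edge_cut A C \<and> card C = k" "card A"] edge_cut_refl[OF assms]
  unfolding cut_size_def by blast

lemma card_min_edge_cut:
  assumes "A \<subseteq> arcs G" "min_edge_cut A C" shows "card C = cut_size A"
  using cut_size_attained[OF assms(1)] cut_size_le assms(2) unfolding min_edge_cut_iff
  by (metis order_antisym)

text \<open>Adding \<open>e\<close> to a smallest cut of \<open>B\<close> also blocks the walks that
  end in \<open>e\<close>.\<close>

lemma cut_size_insert:
  assumes "B \<subseteq> arcs G" "e \<in> arcs G"
  shows "cut_size (insert e B) \<le> Suc (cut_size B)"
proof -
  obtain C where C: "edge_cut B C" "card C = cut_size B"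
    using assms cut_size_attained by blast
  have "edge_cut (insert e B) (insert e C)"
    unfolding edge_cut_def
  proof (intro conjI allI impI)
    show "insert e C \<subseteq> arcs G"
      using C(1) assms(2) by (simp add: edge_cut_subset)
    fix p v assume p: "awalk s p v \<and> p \<noteq> [] \<and> last p \<in> insert e B"
    show "set p \<inter> insert e C \<noteq> {}"
    proof (cases "last p = e")
      case True
      then show ?thesis using p last_in_set[of p] by auto
    next
      case False
      then show ?thesis using p C(1) unfolding edge_cut_def by blast
    qed
  qed
  then have "cut_size (insert e B) \<le> card (insert e C)" by (rule cut_size_le)
  also have "\<dots> \<le> Suc (card C)" by (rule card_insert_le_m1[THEN order_trans]) auto
  finally show ?thesis using C by simp
qed

lemma finite_T: "finite T"
  using sinks_verts finite_verts by (meson Diff_subset finite_subset order_trans)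

lemma C_min_le_card_sink_cut:
  assumes "t \<in> T" "sink_cut t C"
  shows "C_min \<le> card C"
proof -
  have "{C. sink_cut t C} \<subseteq> Pow (arcs G)" by (auto simp: sink_cut_def)
  then have "finite {C. sink_cut t C}" by (rule finite_subset) simp
  then have "min_cut_capacity t \<le> card C"
    unfolding min_cut_capacity_def using assms by (intro Min_le) auto
  moreover have "C_min \<le> min_cut_capacity t"
    unfolding C_min_def using assms finite_T by (intro Min_le) auto
  ultimately show ?thesis by simp
qed

text \<open>As \<open>t\<close> is not the source, every walk from \<open>s\<close> to
  \<open>t\<close> ends in an edge entering \<open>t\<close>. This relates cuts of edge sets to
  \<open>C_min\<close>.\<close>

lemma sink_cut_if_edge_cut:
  assumes "t \<in> T" "edge_cut (in_arcs G t) C"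
  shows "sink_cut t C"
proof -
  have "set p \<inter> C \<noteq> {}" if p: "awalk s p t" for p
  proof -
    have "p \<noteq> []" using p assms(1) sinks_verts by (auto simp: awalk_Nil_iff)
    moreover from this have "last p \<in> in_arcs G t"
      using p by (cases p rule: rev_cases) (auto simp: awalk_append_iff awalk_Cons_iff awalk_Nil_iff)
    ultimately show ?thesis
      using p assms(2) unfolding edge_cut_def by blast
  qed
  then show ?thesis
    using assms(2) unfolding sink_cut_def edge_cut_def by blast
qed

text \<open>Adding the incoming edges of a sink to \<open>A\<close> one at a time raises the size of a minimum cut by
  at most one in each step, so that it takes the value \<open>r\<close>.\<close>

lemma primary_set_covers:
  assumes A: "A \<subseteq> arcs G" "card A \<le> r" and r: "r \<le> C_min"
  obtains D where "D \<in> primary_sets r" "edge_cut A D"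
proof -
  obtain t where t: "t \<in> T" using sinks_nonempty by blast
  have "\<exists>B. A \<subseteq> B \<and> B \<subseteq> arcs G \<and> cut_size B = r"
    if "finite F" "F \<subseteq> arcs G" "r \<le> cut_size (A \<union> F)" for F
    using that
  proof (induction F rule: finite_induct)
    \<comment> \<open>Since \<open>A\<close> cuts itself, \<open>cut_size A\<close> is at most
      \<open>card A\<close> and hence at most \<open>r\<close>.\<close>
    case empty
    then have "cut_size A = r"
      using cut_size_le[OF edge_cut_refl[OF A(1)]] A(2) by simp
    then show ?case using A by blast
  next
    case (insert e F)
    show ?case
    proof (cases "r \<le> cut_size (A \<union> F)")
      case True
      then show ?thesis using insert by blast
    next
      case False
      then have "cut_size (A \<union> insert e F) = r"
        using insert.prems cut_size_insert[of "A \<union> F" e] A by simp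
      then show ?thesis
        using insert.prems A by (intro exI[of _ "A \<union> insert e F"]) auto
    qed
  qed
  \<comment> \<open>A cut of this union separates \<open>t\<close> from the source, so it has at
    least \<open>C_min\<close> edges.\<close>
  moreover have "r \<le> cut_size (A \<union> in_arcs G t)"
  proof -
    have "A \<union> in_arcs G t \<subseteq> arcs G" using A by auto
    then obtain C where C: "edge_cut (A \<union> in_arcs G t) C" "card C = cut_size (A \<union> in_arcs G t)"
      by (rule cut_size_attained)
    have "edge_cut (in_arcs G t) C"
      by (rule edge_cut_mono[OF C(1) _ subset_refl edge_cut_subset[OF C(1)]]) simp
    then show ?thesis
      using r C C_min_le_card_sink_cut[OF t] sink_cut_if_edge_cut[OF t] by (metis order_trans)
  qed
  ultimately obtain B where B: "A \<subseteq> B" "B \<subseteq> arcs G" "cut_size B = r"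
    by (meson finite_in_arcs in_arcs_in_arcs subsetI)
  obtain D where D: "primary_min_cut B D"
    using primary_min_cut_exists[OF B(2)] .
  then have *: "min_edge_cut B D" by (simp add: primary_min_cut_def)
  then have BD: "edge_cut B D" by (simp add: min_edge_cut_iff)
  have "card D = r"
    using card_min_edge_cut[OF B(2) *] B by simp
  then have "D \<in> primary_sets r"
    using primary_min_cut_primary[OF D] edge_cut_subset[OF BD] by (simp add: primary_sets_def)
  moreover have "edge_cut A D"
    by (rule edge_cut_mono[OF BD B(1) subset_refl edge_cut_subset[OF BD]])
  ultimately show ?thesis by (rule that)
qed

end

section \<open>Decodable codes\<close>

context network
begin

section \<open>Processed and pending edges at a vertex set\<close>

definition processed_edges :: "'e set \<Rightarrow> 'v set \<Rightarrow> nat \<Rightarrow> 'e in_edge set" where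
  "processed_edges P X n = (\<Union>x\<in>X. In n x) \<inter> (range Imaginary \<union> Proper ` P)"

text \<open>Only edges with tail outside \<open>X\<close> count here, whereas
  \<open>processed_edges\<close> also contains edges inside \<open>X\<close>, and the imaginary
  edges whenever \<open>s\<close> lies in \<open>X\<close>.\<close>

definition pending_edges :: "'e set \<Rightarrow> 'v set \<Rightarrow> 'e set" where
  "pending_edges P X = {e \<in> arcs G - P. head G e \<in> X \<and> tail G e \<notin> X}"

definition zeros :: "nat \<Rightarrow> ('e in_edge \<Rightarrow> (nat \<Rightarrow> 'f :: field) \<Rightarrow> 'f) \<Rightarrow> 'e in_edge set \<Rightarrow> (nat \<Rightarrow> 'f) set" where
  "zeros n y D = {z \<in> coord_space n. \<forall>d\<in>D. y d z = 0}"

lemma zeros_antimono: "D \<subseteq> D' \<Longrightarrow> zeros n y D' \<subseteq> zeros n y D"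
  by (auto simp: zeros_def)

lemma zeros_Un: "zeros n y (D \<union> D') = zeros n y D \<inter> zeros n y D'"
  by (auto simp: zeros_def)

lemma zeros_subset: "zeros n y D \<subseteq> coord_space n"
  by (auto simp: zeros_def)

lemma finite_zeros [simp]: "finite (zeros n y D :: (nat \<Rightarrow> 'f :: {field, finite}) set)"
  by (rule finite_subset[OF zeros_subset]) simp

lemma subspace_zeros: "(\<And>d. functional (y d)) \<Longrightarrow> fun_vs.subspace (zeros n y D)"
  unfolding zeros_def by (rule subspace_common_zeros[OF subspace_coord_space])

lemma processed_edges_Un:
  "processed_edges P (X \<union> Y) n = processed_edges P X n \<union> processed_edges P Y n"
  by (auto simp: processed_edges_def)

lemma processed_edges_mono: "X \<subseteq> Y \<Longrightarrow> processed_edges P X n \<subseteq> processed_edges P Y n"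
  by (auto simp: processed_edges_def)

lemma finite_pending [simp]: "finite (pending_edges P X)"
  by (simp add: pending_edges_def)

text \<open>An edge crossing into the union or the intersection crosses into \<open>X\<close> or
  \<open>Y\<close>, and an edge crossing into both of them crosses into both \<open>X\<close> and
  \<open>Y\<close>.\<close>

lemma pending_submodular:
  "card (pending_edges P (X \<union> Y)) + card (pending_edges P (X \<inter> Y))
     \<le> card (pending_edges P X) + card (pending_edges P Y)"
proof -
  let ?p = "pending_edges P"
  have "card (?p (X \<union> Y)) + card (?p (X \<inter> Y))
      = card (?p (X \<union> Y) \<union> ?p (X \<inter> Y)) + card (?p (X \<union> Y) \<inter> ?p (X \<inter> Y))"
    by (rule card_Un_Int) auto
  also have "\<dots> \<le> card (?p X \<union> ?p Y) + card (?p X \<inter> ?p Y)"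
    by (intro add_mono card_mono) (auto simp: pending_edges_def)
  also have "\<dots> = card (?p X) + card (?p Y)"
    by (rule card_Un_Int[symmetric]) auto
  finally show ?thesis .
qed

lemma In_proper: "Proper a \<in> In n x \<longleftrightarrow> x \<noteq> s \<and> a \<in> in_arcs G x"
  by (auto simp: In_def)

lemma finite_In [simp]: "finite (In n x)"
  by (simp add: In_def finite_in_arcs)

lemma head_neq_source: "e \<in> arcs G \<Longrightarrow> head G e \<noteq> s"
  using source_in by (auto simp: in_arcs_def)

lemma processed_edges_insert:
  assumes "e \<in> arcs G"
  shows "processed_edges (insert e P) X n =
    (if head G e \<in> X then insert (Proper e) (processed_edges P X n) else processed_edges P X n)"
  using assms head_neq_source[OF assms]
  by (auto simp: processed_edges_def In_proper)

text \<open>A code is built by processing the edges in a topological order. For the set \<open>P\<close> of processed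
  edges, the last condition says that the processed edges entering \<open>X\<close> carry symbols of rank at
  least \<open>n\<close> minus the number of unprocessed edges that still cross into \<open>X\<close>; the
  rank is encoded by the cardinality of the space of inputs on which these symbols vanish.\<close>

definition partial_code :: "nat \<Rightarrow> 'e set \<Rightarrow> ('e in_edge \<Rightarrow> (nat \<Rightarrow> 'f :: {field, finite}) \<Rightarrow> 'f) \<Rightarrow> bool" where
  "partial_code n P y \<longleftrightarrow> P \<subseteq> arcs G \<and> (\<forall>e\<in>P. in_arcs G (tail G e) \<subseteq> P) \<and>
     (\<forall>i. y (Imaginary i) = (\<lambda>z. z i)) \<and> (\<forall>d. functional (y d)) \<and>
     (\<forall>e\<in>P. \<exists>k. y (Proper e) = (\<lambda>z. \<Sum>d\<in>In n (tail G e). k d * y d z)) \<and>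
     (\<forall>t\<in>T. \<forall>X\<subseteq>verts G. t \<in> X \<longrightarrow>
        card (zeros n y (processed_edges P X n)) \<le> CARD('f) ^ card (pending_edges P X))"

lemma partial_code_functional: "partial_code n P y \<Longrightarrow> functional (y d)"
  and partial_code_Imaginary: "partial_code n P y \<Longrightarrow> y (Imaginary i) = (\<lambda>z. z i)"
  and partial_code_Proper: "partial_code n P y \<Longrightarrow> e \<in> P \<Longrightarrow>
         \<exists>k. y (Proper e) = (\<lambda>z. \<Sum>d\<in>In n (tail G e). k d * y d z)"
  by (simp_all add: partial_code_def)

section \<open>Processing one more edge\<close>

definition tight :: "nat \<Rightarrow> 'e set \<Rightarrow> ('e in_edge \<Rightarrow> (nat \<Rightarrow> 'f :: {field, finite}) \<Rightarrow> 'f) \<Rightarrow> 'v set \<Rightarrow> bool" where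
  "tight n P y X \<longleftrightarrow>
     card (zeros n y (processed_edges P X n)) = CARD('f) ^ card (pending_edges P X)"

text \<open>These are the vertex sets on which processing \<open>e\<close> could break the bound:
  \<open>e\<close> crosses into \<open>X\<close>, so the right side drops by a factor q, and there
  is no slack.\<close>

definition tight_sets ::
    "nat \<Rightarrow> 'e set \<Rightarrow> ('e in_edge \<Rightarrow> (nat \<Rightarrow> 'f :: {field, finite}) \<Rightarrow> 'f) \<Rightarrow> 'v \<Rightarrow> 'e \<Rightarrow> 'v set set" where
  "tight_sets n P y t e =
     {X. X \<subseteq> verts G \<and> t \<in> X \<and> head G e \<in> X \<and> tail G e \<notin> X \<and> tight n P y X}"

text \<open>The pending edges are submodular, and the zero spaces satisfy the opposite inequality.
  As the bound holds at the intersection, which contains \<open>t\<close>, no slack remains at the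
  union.\<close>

lemma tight_Un:
  fixes y :: "'e in_edge \<Rightarrow> (nat \<Rightarrow> 'f :: {field, finite}) \<Rightarrow> 'f"
  assumes y: "partial_code n P y" and t: "t \<in> T"
    and X: "X \<subseteq> verts G" "t \<in> X" "tight n P y X" and Y: "Y \<subseteq> verts G" "t \<in> Y" "tight n P y Y"
  shows "tight n P y (X \<union> Y)"
proof -
  let ?Z = "\<lambda>X. zeros n y (processed_edges P X n)" and ?p = "\<lambda>X. card (pending_edges P X)"
  let ?q = "CARD('f)"
  have bound: "card (?Z W) \<le> ?q ^ ?p W" if "W \<subseteq> verts G" "t \<in> W" for W
    using y t that unfolding partial_code_def by blast
  have sub: "fun_vs.subspace (?Z W)" for W
    using y by (intro subspace_zeros) (simp add: partial_code_def)
  have "?q ^ (?p (X \<union> Y) + ?p (X \<inter> Y)) \<le> ?q ^ (?p X + ?p Y)"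
    using pending_submodular card_field_gt_1[where ?'f = 'f] by (intro power_increasing) auto
  also have "\<dots> = card (?Z X) * card (?Z Y)"
    using X Y by (simp add: tight_def power_add)
  also have "\<dots> \<le> card (?Z X \<inter> ?Z Y) * card (?Z (X \<inter> Y))"
    by (intro card_subspace_inter sub finite_zeros zeros_antimono processed_edges_mono) auto
  also have "?Z X \<inter> ?Z Y = ?Z (X \<union> Y)"
    by (simp add: processed_edges_Un zeros_Un)
  also have "card (?Z (X \<union> Y)) * card (?Z (X \<inter> Y)) \<le> card (?Z (X \<union> Y)) * ?q ^ ?p (X \<inter> Y)"
    using bound[of "X \<inter> Y"] X Y by (intro mult_left_mono) auto
  finally have "?q ^ ?p (X \<union> Y) \<le> card (?Z (X \<union> Y))"
    using card_field_gt_1[where ?'f = 'f] by (simp add: power_add)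
  then show ?thesis
    using bound[of "X \<union> Y"] X Y by (simp add: tight_def)
qed

text \<open>Closure under unions yields a largest tight set, and an input whose processed symbols
  vanish there does so at all tight sets. One vector thus stands for all constraints of the
  sink.\<close>

lemma sink_witness:
  fixes y :: "'e in_edge \<Rightarrow> (nat \<Rightarrow> 'f :: {field, finite}) \<Rightarrow> 'f"
  assumes y: "partial_code n P y" and t: "t \<in> T"
    and e: "e \<in> arcs G - P" "in_arcs G (tail G e) \<subseteq> P"
  shows "\<exists>z. (\<forall>X\<in>tight_sets n P y t e. z \<in> zeros n y (processed_edges P X n)) \<and>
             (tight_sets n P y t e \<noteq> {} \<longrightarrow> (\<exists>d\<in>In n (tail G e). y d z \<noteq> 0))"
proof -
  let ?Z = "\<lambda>X. zeros n y (processed_edges P X n)"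
  let ?S = "tight_sets n P y t e"
  show ?thesis
  proof (cases "?S = {}")
    case True
    then show ?thesis by (intro exI[of _ 0]) blast
  next
    case False
    have "finite ?S" by (rule finite_subset[of _ "Pow (verts G)"]) (auto simp: tight_sets_def)
    from finite_has_maximal[OF this False]
    obtain X where X: "X \<in> ?S" and max: "\<forall>Y\<in>?S. X \<subseteq> Y \<longrightarrow> X = Y" by (rule bexE)
    have sub: "?Z X \<subseteq> ?Z Y" if "Y \<in> ?S" for Y
    proof -
      have "X \<union> Y \<in> ?S"
        using X that tight_Un[OF y t, of X Y] by (simp add: tight_sets_def)
      then have "Y \<subseteq> X" using max by blast
      then show ?thesis by (intro zeros_antimono processed_edges_mono)
    qed
    \<comment> \<open>If all of \<open>?Z X\<close> gave zero symbols on the edges entering the tail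
      of \<open>e\<close>, adding this tail to \<open>X\<close> would keep the zeros but lose a
      pending edge, against the bound.\<close>
    have "\<exists>z\<in>?Z X. \<exists>d\<in>In n (tail G e). y d z \<noteq> 0"
    proof (rule ccontr)
      assume contra: "\<not> ?thesis"
      let ?X' = "insert (tail G e) X"
      have "?Z X \<subseteq> ?Z ?X'"
      proof
        fix z assume z: "z \<in> ?Z X"
        then have "\<forall>d\<in>In n (tail G e). y d z = 0" using contra by blast
        with z show "z \<in> ?Z ?X'"
          by (auto simp: zeros_def processed_edges_def)
      qed
      then have le: "CARD('f) ^ card (pending_edges P X) \<le> card (?Z ?X')"
        using X card_mono[OF finite_zeros, of "?Z X" n y "processed_edges P ?X' n"]
        by (simp add: tight_sets_def tight_def)
      have "?X' \<subseteq> verts G" "t \<in> ?X'" using X e by (auto simp: tight_sets_def)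
      then have "card (?Z ?X') \<le> CARD('f) ^ card (pending_edges P ?X')"
        using y t unfolding partial_code_def by blast
      with le have "CARD('f) ^ card (pending_edges P X) \<le> CARD('f) ^ card (pending_edges P ?X')"
        by (rule order_trans)
      also have "\<dots> < CARD('f) ^ card (pending_edges P X)"
      proof (rule power_strict_increasing)
        \<comment> \<open>\<open>e\<close> no longer crosses into the larger set, and no other edge
          starts to, because the edges entering the tail of \<open>e\<close> are all
          processed.\<close>
        have "pending_edges P ?X' \<subset> pending_edges P X"
          using e X by (auto simp: pending_edges_def tight_sets_def)
        then show "card (pending_edges P ?X') < card (pending_edges P X)"
          by (intro psubset_card_mono) auto
      qed (rule card_field_gt_1)
      finally show False by simp
    qed
    then obtain z where "z \<in> ?Z X" "\<exists>d\<in>In n (tail G e). y d z \<noteq> 0" by blast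
    then show ?thesis using sub by (intro exI[of _ z]) blast
  qed
qed

text \<open>The new symbol has to be nonzero at the witness of every sink with tight sets. Each such
  sink forbids a proper subspace of kernels, and fewer than q of these leave some kernel
  over.\<close>

lemma partial_code_insert:
  fixes y :: "'e in_edge \<Rightarrow> (nat \<Rightarrow> 'f :: {field, finite}) \<Rightarrow> 'f"
  assumes y: "partial_code n P y" and e: "e \<in> arcs G - P" "in_arcs G (tail G e) \<subseteq> P"
    and q: "card T < CARD('f)"
  obtains y' :: "'e in_edge \<Rightarrow> (nat \<Rightarrow> 'f) \<Rightarrow> 'f" where "partial_code n (insert e P) y'"
proof -
  let ?q = "CARD('f)"
  let ?D = "In n (tail G e)"
  let ?S = "\<lambda>t. tight_sets n P y t e"
  let ?Z = "\<lambda>X. zeros n y (processed_edges P X n)"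
  note code = y[unfolded partial_code_def]
  note P = conjunct1[OF code]  and code = conjunct2[OF code]
  note P = P conjunct1[OF code]  and code = conjunct2[OF code]
  note y_im = conjunct1[OF code] and code = conjunct2[OF code]
  note y_lin = conjunct1[OF code, rule_format] and code = conjunct2[OF code]
  note y_rec = conjunct1[OF code] and bound = conjunct2[OF code]
  have "\<forall>t\<in>T. \<exists>z. (\<forall>X\<in>?S t. z \<in> ?Z X) \<and> (?S t \<noteq> {} \<longrightarrow> (\<exists>d\<in>?D. y d z \<noteq> 0))"
    using sink_witness[OF y _ e] by simp
  from bchoice[OF this] obtain z where
    "\<forall>t\<in>T. (\<forall>X\<in>?S t. z t \<in> ?Z X) \<and> (?S t \<noteq> {} \<longrightarrow> (\<exists>d\<in>?D. y d (z t) \<noteq> 0))" ..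
  then have z: "\<And>t X. t \<in> T \<Longrightarrow> X \<in> ?S t \<Longrightarrow> z t \<in> ?Z X"
    and z_nz: "\<And>t. t \<in> T \<Longrightarrow> ?S t \<noteq> {} \<Longrightarrow> \<exists>d\<in>?D. y d (z t) \<noteq> 0"
    by simp_all
  define T' where "T' = {t \<in> T. ?S t \<noteq> {}}"
  define W where "W t = {k :: 'e in_edge \<Rightarrow> 'f. (\<Sum>d\<in>?D. y d (z t) * k d) = 0}" for t
  have "\<exists>k\<in>UNIV. \<forall>t\<in>T'. k \<notin> W t"
  proof (rule subspace_cover)
    show "finite T'" by (simp add: T'_def finite_T)
    show "card T' < ?q"
      using card_mono[OF finite_T, of T'] q by (auto simp: T'_def)
    show "fun_vs.subspace (W t) \<and> \<not> UNIV \<subseteq> W t" if t: "t \<in> T'" for t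
    proof
      have "fun_vs.subspace {k \<in> UNIV. \<forall>u\<in>{()}. (\<Sum>d\<in>?D. y d (z t) * k d) = 0}"
        by (intro subspace_common_zeros fun_vs.subspace_UNIV functional_combination functional_proj)
      then show "fun_vs.subspace (W t)" by (simp add: W_def)
      obtain d where d: "d \<in> ?D" "y d (z t) \<noteq> 0"
        using z_nz t by (auto simp: T'_def)
      \<comment> \<open>The unit kernel at \<open>d\<close> copies the nonzero symbol
        \<open>y d (z t)\<close> and so is not forbidden.\<close>
      have "(\<Sum>d'\<in>?D. y d' (z t) * (if d' = d then 1 else 0)) = (\<Sum>d'\<in>?D. if d' = d then y d' (z t) else 0)"
        by (intro sum.cong) auto
      then have "(\<lambda>d'. if d' = d then 1 else 0) \<notin> W t"
        using d by (simp add: W_def)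
      then show "\<not> UNIV \<subseteq> W t" by blast
    qed
  qed (rule fun_vs.subspace_UNIV)
  then obtain k where k: "\<And>t. t \<in> T' \<Longrightarrow> (\<Sum>d\<in>?D. k d * y d (z t)) \<noteq> 0"
    by (auto simp: W_def mult.commute)
  define ye where "ye = (\<lambda>z. \<Sum>d\<in>?D. k d * y d z)"
  define y' where "y' = y(Proper e := ye)"
  have ye_lin: "functional ye"
    unfolding ye_def by (intro functional_combination y_lin)
  \<comment> \<open>\<open>e\<close> enters neither its own tail nor the tail of a processed edge,
    so redefining its symbol disturbs no recursion.\<close>
  have same: "y' d = y d" if "d \<in> In n (tail G a)" "a \<in> insert e P" for a d
  proof -
    have sub: "in_arcs G (tail G a) \<subseteq> P"
      using that(2) P(2) e(2) by auto
    have "d \<noteq> Proper e"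
    proof
      assume "d = Proper e"
      then have "e \<in> in_arcs G (tail G a)" using that(1) by (simp only: In_proper)
      with sub e(1) show False by blast
    qed
    then show ?thesis by (simp add: y'_def)
  qed
  have rec: "\<exists>k. y' (Proper a) = (\<lambda>z. \<Sum>d\<in>In n (tail G a). k d * y' d z)" if a: "a \<in> insert e P" for a
  proof -
    have eq: "(\<lambda>z. \<Sum>d\<in>In n (tail G a). k d * y' d z) = (\<lambda>z. \<Sum>d\<in>In n (tail G a). k d * y d z)" for k
      using same[OF _ a] by (intro ext sum.cong) auto
    show ?thesis
    proof (cases "a = e")
      case True
      then show ?thesis unfolding eq by (auto simp: y'_def ye_def)
    next
      case False
      then show ?thesis unfolding eq using bspec[OF y_rec, of a] a by (simp add: y'_def)
    qed
  qed
  have zeros': "zeros n y' (processed_edges (insert e P) X n) =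
      (if head G e \<in> X then {x \<in> ?Z X. ye x = 0} else ?Z X)" for X
  proof -
    have "Proper e \<notin> processed_edges P X n"
      using e by (auto simp: processed_edges_def)
    then have "zeros n y' (processed_edges P X n) = ?Z X"
      by (auto simp: zeros_def y'_def)
    moreover have "zeros n y' (insert (Proper e) D) = {x \<in> zeros n y' D. ye x = 0}" for D
      by (auto simp: zeros_def y'_def)
    ultimately show ?thesis
      using e by (simp add: processed_edges_insert)
  qed
  have "card (zeros n y' (processed_edges (insert e P) X n)) \<le> ?q ^ card (pending_edges (insert e P) X)"
    if t: "t \<in> T" and X: "X \<subseteq> verts G" "t \<in> X" for t X
  proof (cases "head G e \<in> X \<and> tail G e \<notin> X")
    \<comment> \<open>\<open>e\<close> does not cross into \<open>X\<close>: the pending edges stay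
      the same and the zeros can only shrink.\<close>
    case False
    then have "pending_edges (insert e P) X = pending_edges P X"
      by (auto simp: pending_edges_def)
    moreover have "card (zeros n y' (processed_edges (insert e P) X n)) \<le> card (?Z X)"
      unfolding zeros' by (intro card_mono) auto
    ultimately show ?thesis using bound t X by (metis order_trans)
  next
    case True
    let ?p = "card (pending_edges P X)" and ?K = "{x \<in> ?Z X. ye x = 0}"
    have "pending_edges (insert e P) X = pending_edges P X - {e}" "e \<in> pending_edges P X"
      using e True by (auto simp: pending_edges_def)
    then have pend: "?p = Suc (card (pending_edges (insert e P) X))"
      by (metis card_Suc_Diff1 finite_pending)
    have sub: "fun_vs.subspace (?Z X)"
      by (rule subspace_zeros[OF y_lin])
    have "card ?K \<le> ?q ^ (?p - 1)"
    proof (cases "tight n P y X")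
      case tight: True
      then have S: "X \<in> ?S t" using True X by (simp add: tight_sets_def)
      then have "t \<in> T'" unfolding T'_def using t by blast
      then have "ye (z t) \<noteq> 0" using k by (simp add: ye_def)
      then have "?q * card ?K \<le> card (?Z X)"
        by (intro card_kernel[OF sub finite_zeros ye_lin z[OF t S]])
      also have "\<dots> = ?q * ?q ^ (?p - 1)"
        using tight pend by (simp add: tight_def)
      finally show ?thesis using card_field_gt_1[where ?'f = 'f] by simp
    next
      case False
      \<comment> \<open>Sizes of subspaces are powers of q, so a strict bound leaves a whole factor
        q of slack.\<close>
      obtain j where j: "card (?Z X) = ?q ^ j"
        using card_subspace_power[OF sub finite_zeros] .
      then have "?q ^ j < ?q ^ ?p"
        using bound[rule_format, OF t X] False by (simp add: tight_def)
      then have "j < ?p"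
        using card_field_gt_1[where ?'f = 'f] by (simp add: power_strict_increasing_iff)
      then have "?q ^ j \<le> ?q ^ (?p - 1)"
        by (intro power_increasing) auto
      moreover have "card ?K \<le> card (?Z X)" by (intro card_mono) auto
      ultimately show ?thesis using j by simp
    qed
    then show ?thesis using pend True by (simp add: zeros')
  qed
  moreover have "functional (y' d)" for d
    using y_lin ye_lin by (simp add: y'_def)
  moreover have "y' (Imaginary i) = (\<lambda>z. z i)" for i
    using y_im by (simp add: y'_def)
  ultimately have "partial_code n (insert e P) y'"
    unfolding partial_code_def using P e rec by auto
  then show ?thesis by (rule that)
qed

section \<open>The construction in topological order\<close>

lemma awalk_enters:
  "awalk u p v \<Longrightarrow> u \<notin> X \<Longrightarrow> v \<in> X \<Longrightarrow> \<exists>e\<in>set p. e \<in> arcs G \<and> head G e \<in> X \<and> tail G e \<notin> X"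
proof (induction p arbitrary: u)
  case Nil
  then show ?case by (auto simp: awalk_Nil_iff)
next
  case (Cons a p)
  then have a: "a \<in> arcs G" "tail G a = u" "awalk (head G a) p v"
    by (auto simp: awalk_Cons_iff)
  then show ?case
    using Cons.IH[of "head G a"] Cons.prems by (cases "head G a \<in> X") auto
qed

text \<open>If \<open>s\<close> lies in \<open>X\<close>, the imaginary edges determine the input.
  Otherwise the edges crossing into \<open>X\<close> cut \<open>t\<close> off from the source, so
  there are at least \<open>n\<close> of them.\<close>

lemma partial_code_empty:
  assumes "n \<le> C_min"
  shows "partial_code n {} (\<lambda>d z. case d of Imaginary i \<Rightarrow> z i :: 'f :: {field, finite} | Proper e \<Rightarrow> 0)"
proof -
  let ?y = "\<lambda>(d :: 'e in_edge) z. case d of Imaginary i \<Rightarrow> z i :: 'f | Proper e \<Rightarrow> 0"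
  have "card (zeros n ?y (processed_edges {} X n)) \<le> CARD('f) ^ card (pending_edges {} X)"
    if t: "t \<in> T" "t \<in> X" for t X
  proof (cases "s \<in> X")
    case True
    have "zeros n ?y (processed_edges {} X n) \<subseteq> {0}"
    proof
      fix z assume z: "z \<in> zeros n ?y (processed_edges {} X n)"
      have "z i = 0" for i
      proof (cases "i < n")
        case True
        then have "Imaginary i \<in> processed_edges {} X n"
          using \<open>s \<in> X\<close> by (auto simp: processed_edges_def In_def)
        then show ?thesis using z by (force simp: zeros_def)
      next
        case False
        then show ?thesis using z by (simp add: zeros_def coord_space_def)
      qed
      then show "z \<in> {0}" by (simp add: fun_eq_iff)
    qed
    from card_mono[OF _ this] have "card (zeros n ?y (processed_edges {} X n)) \<le> 1"
      by simp
    also have "1 \<le> CARD('f) ^ card (pending_edges {} X)" by simp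
    finally show ?thesis .
  next
    case False
    then have "sink_cut t (pending_edges {} X)"
      using awalk_enters[of s _ t X] t by (fastforce simp: sink_cut_def pending_edges_def)
    then have "n \<le> card (pending_edges {} X)"
      using C_min_le_card_sink_cut[OF t(1)] assms by (meson order_trans)
    then have "CARD('f) ^ n \<le> CARD('f) ^ card (pending_edges {} X)"
      by (intro power_increasing) auto
    moreover have "card (zeros n ?y (processed_edges {} X n)) \<le> CARD('f) ^ n"
      using card_mono[OF finite_coord_space zeros_subset] unfolding card_coord_space by blast
    ultimately show ?thesis by simp
  qed
  moreover have "functional (?y d)" for d
    by (cases d) (simp_all add: functional_def)
  ultimately show ?thesis
    unfolding partial_code_def by simp
qed

text \<open>Acyclicity makes \<open>arcs_ends G\<close> well-founded; an unprocessed arc whose tail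
  is minimal has only processed arcs entering that tail.\<close>

lemma next_arc:
  assumes "P \<subset> arcs G"
  obtains e where "e \<in> arcs G - P" "in_arcs G (tail G e) \<subseteq> P"
proof -
  have fin: "finite (arcs_ends G)" by (simp add: arcs_ends_def)
  have wf: "wf (arcs_ends G)"
    using acyclic_network fin by (rule finite_acyclic_wf[rotated])
  obtain e0 where "e0 \<in> arcs G - P" using assms by blast
  then have "tail G e0 \<in> tail G ` (arcs G - P)" by blast
  then obtain x where x: "x \<in> tail G ` (arcs G - P)"
    "\<And>w. (w, x) \<in> arcs_ends G \<Longrightarrow> w \<notin> tail G ` (arcs G - P)"
    by (rule wfE_min[OF wf]) (rule that)
  then obtain e where e: "e \<in> arcs G - P" "tail G e = x" by blast
  have "in_arcs G x \<subseteq> P"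
  proof
    fix a assume a: "a \<in> in_arcs G x"
    then have "(tail G a, x) \<in> arcs_ends G" by (force simp: arcs_ends_conv)
    then show "a \<in> P" using x(2) a by fastforce
  qed
  with e that show ?thesis by blast
qed

lemma full_code_exists:
  assumes "n \<le> C_min" and q: "card T < CARD('f :: {field, finite})"
  obtains y :: "'e in_edge \<Rightarrow> (nat \<Rightarrow> 'f :: {field, finite}) \<Rightarrow> 'f" where "partial_code n (arcs G) y"
proof -
  have "\<exists>P (y :: 'e in_edge \<Rightarrow> (nat \<Rightarrow> 'f) \<Rightarrow> 'f). partial_code n P y \<and> card P = m"
    if "m \<le> card (arcs G)" for m
    using that
  proof (induction m)
    case 0
    then show ?case using partial_code_empty[OF assms(1)] by (metis card.empty)
  next
    case (Suc m)
    then obtain P and y :: "'e in_edge \<Rightarrow> (nat \<Rightarrow> 'f) \<Rightarrow> 'f" where P: "partial_code n P y" "card P = m"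
      by auto
    have sub: "P \<subseteq> arcs G" using P(1) by (simp add: partial_code_def)
    then have "P \<subset> arcs G" using P(2) Suc.prems by auto
    then obtain e where e: "e \<in> arcs G - P" "in_arcs G (tail G e) \<subseteq> P"
      by (rule next_arc)
    obtain y' :: "'e in_edge \<Rightarrow> (nat \<Rightarrow> 'f) \<Rightarrow> 'f" where "partial_code n (insert e P) y'"
      using partial_code_insert[OF P(1) e q] .
    moreover have "card (insert e P) = Suc m"
      using e P(2) finite_subset[OF sub finite_arcs] by simp
    ultimately show ?case by blast
  qed
  from this[OF order_refl] obtain P and y :: "'e in_edge \<Rightarrow> (nat \<Rightarrow> 'f) \<Rightarrow> 'f"
    where P: "partial_code n P y" "card P = card (arcs G)" by blast
  moreover have "P \<subseteq> arcs G" using P(1) by (simp add: partial_code_def)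
  ultimately have "P = arcs G" by (simp add: card_subset_eq)
  with P(1) that show ?thesis by blast
qed

text \<open>Symbols behind a cut are determined by those on the cut. An arc that is cut off by
  \<open>C\<close> without belonging to \<open>C\<close> does not start at the source, and the arcs
  entering its tail are cut off too, so induction on the tail applies.\<close>

lemma zeros_cut:
  assumes y: "partial_code n (arcs G) y" and cut: "edge_cut A C"
    and z: "z \<in> zeros n y (Proper ` C)" and A: "A \<subseteq> arcs G"
  shows "z \<in> zeros n y (Proper ` A)"
proof -
  have wf: "wf (arcs_ends G)"
    using acyclic_network by (intro finite_acyclic_wf) (simp_all add: arcs_ends_def)
  have C: "y (Proper c) z = 0" if "c \<in> C" for c
    using z that by (auto simp: zeros_def)
  have "\<forall>a\<in>arcs G. tail G a = u \<and> edge_cut {a} C \<longrightarrow> y (Proper a) z = 0" for u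
  proof (induction u rule: wf_induct_rule[OF wf])
    case (1 u)
    show ?case
    proof (intro ballI impI)
      fix a assume a: "a \<in> arcs G" and u: "tail G a = u \<and> edge_cut {a} C"
      obtain k where k: "y (Proper a) = (\<lambda>z. \<Sum>d\<in>In n (tail G a). k d * y d z)"
        using partial_code_Proper[OF y a] ..
      show "y (Proper a) z = 0"
      proof (cases "a \<in> C")
        case False
        have "y d z = 0" if d: "d \<in> In n u" for d
        proof -
          have "u \<noteq> s"
          proof
            assume "u = s"
            then have "awalk s [a] (head G a)"
              using a u by (auto simp: awalk_Cons_iff awalk_Nil_iff)
            moreover have "set [a] \<inter> C = {}" using False by simp
            ultimately show False
              using u unfolding edge_cut_def by (metis last.simps not_Cons_self2 singletonI)
          qed
          then obtain b where b: "d = Proper b" "b \<in> in_arcs G u"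
            using d by (auto simp: In_def)
          have "edge_cut {b} C"
            unfolding edge_cut_def
          proof (intro conjI allI impI)
            fix p v assume p: "awalk s p v \<and> p \<noteq> [] \<and> last p \<in> {b}"
            have "v = u"
              using p b by (cases p rule: rev_cases) (auto simp: awalk_append_iff awalk_Cons_iff awalk_Nil_iff)
            then have "awalk s (p @ [a]) (head G a)"
              using p a u by (auto simp: awalk_append_iff awalk_Cons_iff awalk_Nil_iff)
            then have "set (p @ [a]) \<inter> C \<noteq> {}"
              using u unfolding edge_cut_def by (metis last_snoc singletonI snoc_eq_iff_butlast)
            then show "set p \<inter> C \<noteq> {}" using False by auto
          qed (use cut edge_cut_subset in blast)
          moreover have "(tail G b, u) \<in> arcs_ends G"
            using b by (force simp: arcs_ends_conv)
          ultimately show ?thesis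
            using 1 b by auto
        qed
        then show ?thesis using u by (simp add: k)
      qed (rule C)
    qed
  qed
  moreover have "edge_cut {a} C" if "a \<in> A" for a
    by (rule edge_cut_mono[OF cut _ subset_refl edge_cut_subset[OF cut]]) (simp add: that)
  ultimately show ?thesis
    using z A by (auto simp: zeros_def)
qed

end

section \<open>Precoding at the source\<close>

context network
begin

text \<open>The \<open>i\<close>-th imaginary edge injects the vector \<open>Q i\<close> into a
  fixed \<open>N\<close>-dimensional code, so the source kernel is a matrix product. Away from the
  source nothing depends on \<open>Q\<close>, which makes the family
  local-encoding-preserving.\<close>

definition precoded_kernels ::
    "nat \<Rightarrow> ('e \<Rightarrow> 'e in_edge \<Rightarrow> 'f :: field) \<Rightarrow> (nat \<Rightarrow> nat \<Rightarrow> 'f) \<Rightarrow> ('v, 'e, 'f) kernels" where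
  "precoded_kernels N k Q v d e =
     (if v = s then case d of Imaginary i \<Rightarrow> \<Sum>j<N. k e (Imaginary j) * Q i j | Proper a \<Rightarrow> 0
      else k e d)"

text \<open>At the source the sums over \<open>i\<close> and \<open>j\<close> are exchanged; from
  there on both codes obey the same recursion.\<close>

lemma symbol_precoded:
  assumes y: "partial_code N (arcs G) y"
    and k: "\<forall>e\<in>arcs G. y (Proper e) = (\<lambda>z. \<Sum>d\<in>In N (tail G e). k e d * y d z)"
    and e: "e \<in> arcs G"
  shows "symbol n (precoded_kernels N k Q) x (Proper e) = y (Proper e) (\<Sum>i<n. (x $ i) *f Q i)"
proof -
  define z where "z = (\<Sum>i<n. (x $ i) *f Q i)"
  let ?K = "precoded_kernels N k Q"
  have wf: "wf (arcs_ends G)"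
    using acyclic_network by (intro finite_acyclic_wf) (simp_all add: arcs_ends_def)
  have "\<forall>e\<in>arcs G. tail G e = u \<longrightarrow> symbol n ?K x (Proper e) = y (Proper e) z" for u
  proof (induction u rule: wf_induct_rule[OF wf])
    case (1 u)
    show ?case
    proof (intro ballI impI)
      fix e assume e: "e \<in> arcs G" and u: "tail G e = u"
      show "symbol n ?K x (Proper e) = y (Proper e) z"
      proof (cases "u = s")
        case True
        have "symbol n ?K x (Proper e) = (\<Sum>i<n. (\<Sum>j<N. k e (Imaginary j) * Q i j) * x $ i)"
          using e u True by (simp add: In_def sum.reindex inj_on_def precoded_kernels_def)
        also have "\<dots> = (\<Sum>j<N. \<Sum>i<n. k e (Imaginary j) * Q i j * x $ i)"
          unfolding sum_distrib_right by (rule sum.swap)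
        also have "\<dots> = (\<Sum>j<N. k e (Imaginary j) * z j)"
          unfolding z_def functional_sum[OF functional_proj]
          by (simp add: sum_distrib_left mult_ac)
        also have "\<dots> = y (Proper e) z"
          using e u True by (simp add: k In_def sum.reindex inj_on_def partial_code_Imaginary[OF y])
        finally show ?thesis .
      next
        case False
        have "symbol n ?K x d = y d z" if d: "d \<in> In N u" for d
        proof -
          obtain b where b: "d = Proper b" "b \<in> in_arcs G u"
            using d False by (auto simp: In_def)
          then have "(tail G b, u) \<in> arcs_ends G" by (force simp: arcs_ends_conv)
          then show ?thesis using 1 b by (auto simp del: symbol.simps)
        qed
        moreover have "In n u = In N u" using False by (simp add: In_def)
        ultimately show ?thesis
          using e u False by (simp add: k precoded_kernels_def)
      qed
    qed
  qed
  with e show ?thesis by (simp add: z_def del: symbol.simps)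
qed

text \<open>The vectors \<open>u j\<close> with \<open>j < r\<close> carry the key and the following
  \<open>\<omega>\<close> ones the message. The input lists the message first, hence the rearranged
  index.\<close>

lemma symbols_on_precoded:
  assumes y: "partial_code N (arcs G) y"
    and k: "\<forall>e\<in>arcs G. y (Proper e) = (\<lambda>z. \<Sum>d\<in>In N (tail G e). k e d * y d z)"
    and A: "A \<subseteq> arcs G" and m: "m \<in> carrier_vec \<omega>" and l: "l \<in> carrier_vec r"
  shows "symbols_on \<omega> r (precoded_kernels N k (\<lambda>i. u (if i < \<omega> then r + i else i - \<omega>))) A (m, l)
    = (\<lambda>e\<in>A. y (Proper e) ((\<Sum>i<\<omega>. (m $ i) *f u (r + i)) + (\<Sum>j<r. (l $ j) *f u j)))"
proof -
  have eq: "(\<Sum>i<\<omega> + r. ((m @\<^sub>v l) $ i) *f u (if i < \<omega> then r + i else i - \<omega>))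
      = (\<Sum>i<\<omega>. (m $ i) *f u (r + i)) + (\<Sum>j<r. (l $ j) *f u j)"
    unfolding sum_lessThan_add using m l by (intro arg_cong2[where f = "(+)"] sum.cong) auto
  show ?thesis
    unfolding symbols_on_def prod.case
    by (rule restrict_ext) (simp only: symbol_precoded[OF y k subsetD[OF A]] eq)
qed

text \<open>A sink can recover the injected vector; two inputs giving the same one yield a relation
  among the \<open>u j\<close>, and \<open>indep\<close> makes their messages agree. The keys may
  differ.\<close>

lemma decodable_precoded:
  fixes y :: "'e in_edge \<Rightarrow> (nat \<Rightarrow> 'f :: {field, finite}) \<Rightarrow> 'f"
  assumes y: "partial_code N (arcs G) y"
    and k: "\<forall>e\<in>arcs G. y (Proper e) = (\<lambda>z. \<Sum>d\<in>In N (tail G e). k e d * y d z)"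
    and u: "\<And>j. j < N \<Longrightarrow> u j \<in> coord_space N"
    and indep: "\<And>c j. (\<Sum>j<N. c j *f u j) = 0 \<Longrightarrow> r \<le> j \<Longrightarrow> j < N \<Longrightarrow> c j = 0"
    and le: "r + \<omega> \<le> N"
  shows "decodable \<omega> r (precoded_kernels N k (\<lambda>i. u (if i < \<omega> then r + i else i - \<omega>)))"
  unfolding decodable_def
proof
  let ?Y = "\<lambda>t. symbols_on \<omega> r (precoded_kernels N k (\<lambda>i. u (if i < \<omega> then r + i else i - \<omega>))) (in_arcs G t)"
  let ?z = "\<lambda>m l. (\<Sum>i<\<omega>. (m $ i) *f u (r + i)) + (\<Sum>j<r. (l $ j) *f u j)"
  fix t assume t: "t \<in> T"
  \<comment> \<open>No edge is pending any more, so the invariant for \<open>X = {t}\<close> leaves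
    0 as the only input with zero symbols at \<open>t\<close>.\<close>
  have zeros: "zeros N y (Proper ` in_arcs G t) \<subseteq> {0}"
  proof -
    have ts: "t \<noteq> s" "t \<in> verts G" using t sinks_verts by auto
    have "processed_edges (arcs G) {t} N = Proper ` in_arcs G t" "pending_edges (arcs G) {t} = {}"
      using ts by (auto simp: processed_edges_def pending_edges_def In_def)
    moreover have "card (zeros N y (processed_edges (arcs G) {t} N))
        \<le> CARD('f) ^ card (pending_edges (arcs G) {t})"
      using y t ts unfolding partial_code_def by simp
    ultimately have "card (zeros N y (Proper ` in_arcs G t)) \<le> Suc 0" by simp
    moreover have "0 \<in> zeros N y (Proper ` in_arcs G t)"
      by (rule fun_vs.subspace_0[OF subspace_zeros[OF partial_code_functional[OF y]]])
    ultimately show ?thesis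
      using card_le_Suc0_iff_eq[OF finite_zeros] by blast
  qed
  have inj: "m = m'" if ml: "m \<in> carrier_vec \<omega>" "l \<in> carrier_vec r" "m' \<in> carrier_vec \<omega>" "l' \<in> carrier_vec r"
    and eq: "?Y t (m, l) = ?Y t (m', l')" for m l m' l'
  proof -
    have z_mem: "?z m l \<in> coord_space N" for m l :: "'f Matrix.vec"
      using le by (intro fun_vs.subspace_add[OF subspace_coord_space]
          fun_vs.subspace_sum[OF subspace_coord_space] fun_vs.subspace_scale[OF subspace_coord_space] u) auto
    have "y (Proper e) (?z m l - ?z m' l') = 0" if "e \<in> in_arcs G t" for e
    proof -
      have sub: "in_arcs G t \<subseteq> arcs G" by auto
      have "y (Proper e) (?z m l) = y (Proper e) (?z m' l')"
        using fun_cong[OF eq, of e] that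
        unfolding symbols_on_precoded[OF y k sub ml(1,2)] symbols_on_precoded[OF y k sub ml(3,4)] by simp
      then show ?thesis by (simp add: functional_diff[OF partial_code_functional[OF y]])
    qed
    then have "?z m l - ?z m' l' \<in> zeros N y (Proper ` in_arcs G t)"
      using fun_vs.subspace_diff[OF subspace_coord_space z_mem z_mem] by (auto simp: zeros_def simp del: in_in_arcs_conv)
    then have z0: "?z m l - ?z m' l' = 0" using zeros by blast
    \<comment> \<open>The differences of keys and messages in the order of \<open>u\<close>, padded
      with zeros up to \<open>N\<close>.\<close>
    define c where "c j = (if j < r then l $ j - l' $ j else if j < r + \<omega> then m $ (j - r) - m' $ (j - r) else 0)" for j
    have "(\<Sum>j<N. c j *f u j) = (\<Sum>j<r + \<omega>. c j *f u j)"
      using le by (intro sum.mono_neutral_right) (auto simp: c_def)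
    also have "\<dots> = (\<Sum>j<r. c j *f u j) + (\<Sum>i<\<omega>. c (r + i) *f u (r + i))"
      by (rule sum_lessThan_add)
    also have "(\<Sum>j<r. c j *f u j) = (\<Sum>j<r. (l $ j - l' $ j) *f u j)"
      by (intro sum.cong) (auto simp: c_def)
    also have "(\<Sum>i<\<omega>. c (r + i) *f u (r + i)) = (\<Sum>i<\<omega>. (m $ i - m' $ i) *f u (r + i))"
      by (intro sum.cong) (auto simp: c_def)
    also have "(\<Sum>j<r. (l $ j - l' $ j) *f u j) + (\<Sum>i<\<omega>. (m $ i - m' $ i) *f u (r + i)) = ?z m l - ?z m' l'"
      by (simp add: fun_vs.scale_left_diff_distrib sum_subtractf del: fscale_apply)
    finally have "(\<Sum>j<N. c j *f u j) = 0"
      using z0 by (rule trans)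
    then have "c (r + i) = 0" if "i < \<omega>" for i
      by (rule indep) (use that le in simp_all)
    then have "m $ i = m' $ i" if "i < \<omega>" for i
      using that by (force simp: c_def)
    then show ?thesis using ml by (intro eq_vecI) auto
  qed
  show "\<exists>D. \<forall>m\<in>carrier_vec \<omega>. \<forall>l\<in>carrier_vec r. D (?Y t (m, l)) = m"
  proof (intro exI ballI)
    fix m l :: "'f Matrix.vec" assume ml: "m \<in> carrier_vec \<omega>" "l \<in> carrier_vec r"
    \<comment> \<open>The decoder picks any message consistent with the received symbols;
      \<open>inj\<close> makes it unique.\<close>
    let ?D = "\<lambda>c. SOME m. m \<in> carrier_vec \<omega> \<and> (\<exists>l\<in>carrier_vec r. ?Y t (m, l) = c)"
    have "?D (?Y t (m, l)) \<in> carrier_vec \<omega> \<and> (\<exists>l'\<in>carrier_vec r. ?Y t (?D (?Y t (m, l)), l') = ?Y t (m, l))"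
      by (rule someI[of _ m]) (use ml in blast)
    then show "?D (?Y t (m, l)) = m"
      using inj ml by blast
  qed
qed

text \<open>For each message some key \<open>l0\<close> yields the same symbols on \<open>D\<close>,
  hence on \<open>A\<close> behind it, as the message does. Translating keys by \<open>l0\<close>
  therefore matches the keys for this message with those for the zero message, symbol by
  symbol.\<close>

lemma secure_precoded:
  fixes y :: "'e in_edge \<Rightarrow> (nat \<Rightarrow> 'f :: {field, finite}) \<Rightarrow> 'f"
  assumes y: "partial_code N (arcs G) y"
    and k: "\<forall>e\<in>arcs G. y (Proper e) = (\<lambda>z. \<Sum>d\<in>In N (tail G e). k e d * y d z)"
    and u: "\<And>j. j < N \<Longrightarrow> u j \<in> coord_space N"
    and compl: "\<And>D x. D \<in> primary_sets r \<Longrightarrow> x \<in> coord_space N \<Longrightarrow>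
        \<exists>c. x - (\<Sum>j<r. c j *f u j) \<in> zeros N y (Proper ` D)"
    and le: "r + \<omega> \<le> N" and r: "r \<le> C_min"
  shows "secure \<omega> r (precoded_kernels N k (\<lambda>i. u (if i < \<omega> then r + i else i - \<omega>)))"
  unfolding secure_def
proof (intro allI impI)
  fix A assume A: "A \<subseteq> arcs G \<and> card A \<le> r"
  let ?Y = "symbols_on \<omega> r (precoded_kernels N k (\<lambda>i. u (if i < \<omega> then r + i else i - \<omega>))) A"
  let ?x = "\<lambda>m :: 'f Matrix.vec. \<Sum>i<\<omega>. (m $ i) *f u (r + i)"
  let ?w = "\<lambda>l :: 'f Matrix.vec. \<Sum>j<r. (l $ j) *f u j"
  have A': "A \<subseteq> arcs G" using A by blast
  have Y: "?Y (m, l) = (\<lambda>e\<in>A. y (Proper e) (?x m + ?w l))"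
    if "m \<in> carrier_vec \<omega>" "l \<in> carrier_vec r" for m l
    using that by (rule symbols_on_precoded[OF y k A'])
  obtain D where D: "D \<in> primary_sets r" "edge_cut A D"
    using primary_set_covers[of A r] A r by blast
  \<comment> \<open>The zero message serves as the reference for the common fibre sizes.\<close>
  let ?n = "\<lambda>c. card {l \<in> carrier_vec r. ?Y (0\<^sub>v \<omega>, l) = c}"
  have "card {l \<in> carrier_vec r. ?Y (m, l) = c} = ?n c" if m: "m \<in> carrier_vec \<omega>" for m c
  proof -
    have "?x m \<in> coord_space N"
      using le by (intro fun_vs.subspace_sum[OF subspace_coord_space]
          fun_vs.subspace_scale[OF subspace_coord_space] u) auto
    then obtain b where b: "?x m - (\<Sum>j<r. b j *f u j) \<in> zeros N y (Proper ` D)"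
      using compl[OF D(1)] by blast
    define l0 where "l0 = Matrix.vec r b"
    have l0: "l0 \<in> carrier_vec r" by (simp add: l0_def)
    have "?x m - ?w l0 = ?x m - (\<Sum>j<r. b j *f u j)"
      by (intro arg_cong2[where f = minus] sum.cong) (auto simp: l0_def)
    with b have "?x m - ?w l0 \<in> zeros N y (Proper ` A)"
      using zeros_cut[OF y D(2) _ A'] by simp
    then have zero: "y (Proper e) (?x m - ?w l0) = 0" if "e \<in> A" for e
      using that by (simp add: zeros_def)
    have shift: "?Y (m, l) = ?Y (0\<^sub>v \<omega>, l + l0)" if l: "l \<in> carrier_vec r" for l
    proof -
      have "y (Proper e) (?x m + ?w l) = y (Proper e) (?x (0\<^sub>v \<omega>) + ?w (l + l0))" if e: "e \<in> A" for e
      proof -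
        have x0: "?x (0\<^sub>v \<omega>) = 0" by (intro sum.neutral) auto
        have "?w (l + l0) = ?w l + ?w l0"
          unfolding sum.distrib[symmetric] using l l0
          by (intro sum.cong) (auto simp: fun_vs.scale_left_distrib simp del: fscale_apply)
        then have split: "?x m + ?w l = (?x m - ?w l0) + (?x (0\<^sub>v \<omega>) + ?w (l + l0))"
          by (simp add: x0)
        have "y (Proper e) (?x m + ?w l) = y (Proper e) (?x m - ?w l0) + y (Proper e) (?x (0\<^sub>v \<omega>) + ?w (l + l0))"
          by (subst split) (rule functional_add[OF partial_code_functional[OF y]])
        then show ?thesis by (simp only: zero[OF e] add_0)
      qed
      then show ?thesis
        unfolding Y[OF m l] Y[OF zero_carrier_vec add_carrier_vec[OF l l0]] by (rule restrict_ext)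
    qed
    have "bij_betw (\<lambda>l. l + l0) {l \<in> carrier_vec r. ?Y (m, l) = c} {l \<in> carrier_vec r. ?Y (0\<^sub>v \<omega>, l) = c}"
    proof (rule bij_betw_byWitness[where f' = "\<lambda>l. l - l0"])
      show "\<forall>l\<in>{l \<in> carrier_vec r. ?Y (m, l) = c}. l + l0 - l0 = l"
        using l0 by (auto intro!: eq_vecI)
      show "\<forall>l\<in>{l \<in> carrier_vec r. ?Y (0\<^sub>v \<omega>, l) = c}. l - l0 + l0 = l"
        using l0 by (auto intro!: eq_vecI)
      show "(\<lambda>l. l + l0) ` {l \<in> carrier_vec r. ?Y (m, l) = c} \<subseteq> {l \<in> carrier_vec r. ?Y (0\<^sub>v \<omega>, l) = c}"
        using l0 shift by auto
      show "(\<lambda>l. l - l0) ` {l \<in> carrier_vec r. ?Y (0\<^sub>v \<omega>, l) = c} \<subseteq> {l \<in> carrier_vec r. ?Y (m, l) = c}"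
      proof (intro image_subsetI CollectI conjI)
        fix l assume "l \<in> {l \<in> carrier_vec r. ?Y (0\<^sub>v \<omega>, l) = c}"
        then have l: "l \<in> carrier_vec r" "?Y (0\<^sub>v \<omega>, l) = c" by blast+
        show "l - l0 \<in> carrier_vec r" using l l0 by simp
        have "l - l0 + l0 = l" using l l0 by (auto intro!: eq_vecI)
        then show "?Y (m, l - l0) = c" using shift[of "l - l0"] l l0 by simp
      qed
    qed
    then show ?thesis by (rule bij_betw_same_card)
  qed
  moreover have "carrier_vec n \<noteq> ({} :: 'f Matrix.vec set)" for n
    using zero_carrier_vec[of n] by (metis empty_iff)
  ultimately show "mutual_info (message_key_space \<omega> r) ?Y fst = 0"
    unfolding message_key_space_def
    by (intro mutual_info_fst_eq_0[OF finite_carrier_vec _ finite_carrier_vec])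
qed

end

section \<open>The family of codes for all rates\<close>

theorem mainTheorem2:
  fixes G :: "('v, 'e) pre_digraph" and s :: 'v and T :: "'v set" and r :: nat
  assumes "network G s T"
    and "r \<le> network.C_min G s T"
    and "CARD('f :: {field, finite}) > max (card T) (card (network.primary_sets G s r))"
  shows "\<exists>\<K> :: nat \<Rightarrow> ('v, 'e, 'f) kernels.
           network.local_encoding_preserving G s T {0..network.C_min G s T - r} \<K> \<and>
           (\<forall>\<omega>\<in>{0..network.C_min G s T - r}. network.SLNC G s T \<omega> r (\<K> \<omega>))"
proof -
  interpret network G s T by fact
  let ?N = C_min
  have q: "card T < CARD('f)" "card (primary_sets r) < CARD('f)" using assms(3) by simp_all
  obtain y :: "'e in_edge \<Rightarrow> (nat \<Rightarrow> 'f) \<Rightarrow> 'f" where y: "partial_code ?N (arcs G) y"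
    using full_code_exists[OF order_refl q(1)] .
  have "\<forall>e\<in>arcs G. \<exists>k. y (Proper e) = (\<lambda>z. \<Sum>d\<in>In ?N (tail G e). k d * y d z)"
    using partial_code_Proper[OF y] by simp
  from bchoice[OF this] obtain k where
    k: "\<forall>e\<in>arcs G. y (Proper e) = (\<lambda>z. \<Sum>d\<in>In ?N (tail G e). k e d * y d z)" ..
  \<comment> \<open>A set in \<open>primary_sets r\<close> has \<open>r\<close> edges, so its zero
    space has codimension at most \<open>r\<close>. The vectors \<open>V j\<close> will carry the
    key.\<close>
  have "\<exists>V. (\<forall>j<r. V j \<in> coord_space ?N) \<and>
      (\<forall>D\<in>primary_sets r. \<forall>x\<in>coord_space ?N. \<exists>c. x - (\<Sum>j<r. c j *f V j) \<in> zeros ?N y (Proper ` D))"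
  proof (rule simultaneous_complement[OF _ q(2)])
    show "finite (primary_sets r)"
      by (rule finite_subset[of _ "Pow (arcs G)"]) (auto simp: primary_sets_def)
    fix D assume "D \<in> primary_sets r"
    then have D: "D \<subseteq> arcs G" "card D = r" by (auto simp: primary_sets_def)
    then have "finite (Proper ` D)" "card (Proper ` D) = r"
      using finite_subset[OF D(1) finite_arcs] by (simp_all add: card_image inj_on_def)
    then have "CARD('f) ^ ?N \<le> card (zeros ?N y (Proper ` D)) * CARD('f) ^ r"
      using card_zeros_ge[of "Proper ` D" y ?N] partial_code_functional[OF y] by (simp add: zeros_def)
    then show "fun_vs.subspace (zeros ?N y (Proper ` D)) \<and> zeros ?N y (Proper ` D) \<subseteq> coord_space ?N \<and>
        CARD('f) ^ ?N \<le> card (zeros ?N y (Proper ` D)) * CARD('f) ^ r"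
      by (intro conjI subspace_zeros partial_code_functional[OF y] zeros_subset)
  qed
  then obtain V where V: "\<forall>j<r. V j \<in> coord_space ?N"
    and compl: "\<forall>D\<in>primary_sets r. \<forall>x\<in>coord_space ?N.
        \<exists>c. x - (\<Sum>j<r. c j *f V j) \<in> zeros ?N y (Proper ` D)"
    by (elim exE conjE) (rule that)
  \<comment> \<open>The added vectors carry the message; extending up to \<open>C_min\<close> at
    once serves every rate.\<close>
  have "\<exists>u. (\<forall>j<r. u j = V j) \<and> (\<forall>j<?N. u j \<in> coord_space ?N) \<and>
      (\<forall>c. (\<Sum>j<?N. c j *f u j) = 0 \<longrightarrow> (\<forall>j. r \<le> j \<and> j < ?N \<longrightarrow> c j = 0))"
    by (rule extend_independently[OF _ assms(2) order_refl]) (rule V[rule_format])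
  then obtain u where uV: "\<forall>j<r. u j = V j" and u: "\<forall>j<?N. u j \<in> coord_space ?N"
    and indep: "\<forall>c. (\<Sum>j<?N. c j *f u j) = 0 \<longrightarrow> (\<forall>j. r \<le> j \<and> j < ?N \<longrightarrow> c j = 0)"
    by (elim exE conjE) (rule that)
  have sum_uV: "(\<Sum>j<r. c j *f u j) = (\<Sum>j<r. c j *f V j)" for c
    by (intro sum.cong) (auto simp: uV)
  \<comment> \<open>All rates share \<open>y\<close>, \<open>k\<close> and \<open>u\<close>;
    \<open>\<omega>\<close> only selects the vectors of \<open>u\<close> that are injected at the
    source.\<close>
  define \<K> where "\<K> \<omega> = precoded_kernels ?N k (\<lambda>i. u (if i < \<omega> then r + i else i - \<omega>))" for \<omega>
  have "SLNC \<omega> r (\<K> \<omega>)" if "\<omega> \<in> {0..?N - r}" for \<omega>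
  proof -
    have le: "r + \<omega> \<le> ?N" using that assms(2) by simp
    have "decodable \<omega> r (\<K> \<omega>)"
      unfolding \<K>_def by (rule decodable_precoded[OF y k _ _ le]; (erule u[rule_format] | erule (2) indep[rule_format, OF _ conjI]))
    moreover have "secure \<omega> r (\<K> \<omega>)"
      unfolding \<K>_def
      by (rule secure_precoded[OF y k _ _ le assms(2)])
        (simp_all only: sum_uV compl[rule_format] u[rule_format])
    ultimately show ?thesis by (simp add: SLNC_def)
  qed
  moreover have "local_encoding_preserving {0..?N - r} \<K>"
    by (simp add: local_encoding_preserving_def intermediate_nodes_def \<K>_def precoded_kernels_def)
  ultimately show ?thesis by blast
qed

end
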